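(* Any real eigenvalue $\lambda$ of $\mathcal P^{-1}\mathcal A$ belongs to $\mathcal I_{\le N+1}$.
   Context: Let $N\ge 1$. Let $A_0\in\mathbb{R}^{n_0\times n_0}$ be symmetric positive definite, $A_k\in\mathbb{R}^{n_k\times n_k}$ symmetric positive semi-definite for $k=1,\dots,N$, and let $B_k\in\mathbb{R}^{n_k\times n_{k-1}}$ have full rank with $n_k\le n_{k-1}$ for $k=1,\dots,N$. Let $\widehat S_k\in\mathbb{R}^{n_k\times n_k}$, $k=0,\dots,N$, be symmetric positive definite (they play the role of approximations of $\widetilde S_0=A_0$ and $\widetilde S_k=A_k+B_k\widehat S_{k-1}^{-1}B_k^\top$). $\mathcal A$ is the symmetric block-tridiagonal matrix with diagonal blocks $A_0,-A_1,A_2,\dots,(-1)^NA_N$, sub-diagonal blocks $B_1,\dots,B_N$ and super-diagonal blocks $B_1^\top,\dots,B_N^\top$. $\mathcal P$ is the block upper bidiagonal matrix with diagonal blocks $\widehat S_0,-\widehat S_1,\widehat S_2,\dots,(-1)^N\widehat S_N$ and super-diagonal blocks $B_1^\top,\dots,B_N^\top$. Set $E_k=\widehat S_k^{-1/2}A_k\widehat S_k^{-1/2}$ ($k=0,\dots,N$) and $R_k=\widehat S_k^{-1/2}B_k\widehat S_{k-1}^{-1/2}$ ($k=1,\dots,N$). Let $\alpha_E^{(k)},\beta_E^{(k)}$ be the smallest and largest eigenvalues of $E_k$ ($k=0,\dots,N$), and $\alpha_R^{(k)},\beta_R^{(k)}$ the smallest and largest eigenvalues of $R_kR_k^\top$ ($k=1,\dots,N$).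 For parameters $\gamma_E^{(k)}\in[\alpha_E^{(k)},\beta_E^{(k)}]$ ($0\le k\le N$) and $\gamma_R^{(k)}\in[\alpha_R^{(k)},\beta_R^{(k)}]$ ($1\le k\le N$), define polynomials in $\lambda$ by $V_0=1$, $V_1(\lambda)=\lambda-\gamma_E^{(0)}$ and $$V_{k+1}(\lambda)=(\lambda-\gamma_E^{(k)})V_k(\lambda)-(\lambda-1)\gamma_R^{(k)}V_{k-1}(\lambda),\qquad 1\le k\le N.$$ $\mathcal I_k$ denotes the union of the minimal closed intervals containing all real roots of the polynomials $V_k$ over the valid range of the parameters, i.e. the set of all $\lambda\in\mathbb{R}$ such that $V_k(\lambda)=0$ for some choice of the parameters $\gamma_E^{(j)}\in[\alpha_E^{(j)},\beta_E^{(j)}]$ ($0\le j\le N$) and $\gamma_R^{(j)}\in[\alpha_R^{(j)},\beta_R^{(j)}]$ ($1\le j\le N$). Moreover $\mathcal I_{\le k}=\bigcup_{j=1}^k\mathcal I_j$. *)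

theory Defs
  imports
    "Jordan_Normal_Form.Matrix"
    "Jordan_Normal_Form.Spectral_Radius"
    "Jordan_Normal_Form.DL_Rank"
    "Jordan_Normal_Form.Gauss_Jordan_Elimination"
    "HOL-Computational_Algebra.Polynomial"
begin

definition sym_psd :: "nat \<Rightarrow> real mat \<Rightarrow> bool" where
  "sym_psd n M \<longleftrightarrow> M \<in> carrier_mat n n \<and> M\<^sup>T = M \<and>
     (\<forall>v \<in> carrier_vec n. v \<bullet> (M *\<^sub>v v) \<ge> 0)"

definition sym_pd :: "nat \<Rightarrow> real mat \<Rightarrow> bool" where
  "sym_pd n M \<longleftrightarrow> M \<in> carrier_mat n n \<and> M\<^sup>T = M \<and>
     (\<forall>v \<in> carrier_vec n. v \<noteq> 0\<^sub>v n \<longrightarrow> v \<bullet> (M *\<^sub>v v) > 0)"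

definition full_rank :: "real mat \<Rightarrow> bool" where
  "full_rank M \<longleftrightarrow> vec_space.rank (dim_row M) M = min (dim_row M) (dim_col M)"

text \<open>Only ever applied to invertible matrices; \<open>the\<close> drops the option
  returned by the library function.\<close>
abbreviation mat_inv :: "real mat \<Rightarrow> real mat" where
  "mat_inv M \<equiv> the (mat_inverse M)"

text \<open>The principal square root, i.e. the unique symmetric positive semi-definite one
  (for symmetric positive semi-definite \<open>M\<close>).\<close>
definition mat_sqrt :: "real mat \<Rightarrow> real mat" where
  "mat_sqrt M = (THE Q. sym_psd (dim_row M) Q \<and> Q * Q = M)"

definition mat_inv_sqrt :: "real mat \<Rightarrow> real mat" where
  "mat_inv_sqrt M = mat_inv (mat_sqrt M)"

text \<open>For block sizes \<open>n 0, n 1, \<dots>\<close>: the global row \<open>r\<close> lies in block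
  \<open>block_index n r\<close>, whose first row has the global number
  \<open>block_offset n (block_index n r)\<close>.  All indices start at 0.\<close>
definition block_offset :: "(nat \<Rightarrow> nat) \<Rightarrow> nat \<Rightarrow> nat" where
  "block_offset n k = (\<Sum>j<k. n j)"

definition block_index :: "(nat \<Rightarrow> nat) \<Rightarrow> nat \<Rightarrow> nat" where
  "block_index n r = (LEAST k. r < block_offset n (Suc k))"

text \<open>The square matrix with blocks \<open>F i j\<close> of size \<open>n i \<times> n j\<close>, \<open>i, j \<in> {0..N}\<close>.\<close>
definition block_matrix :: "nat \<Rightarrow> (nat \<Rightarrow> nat) \<Rightarrow> (nat \<Rightarrow> nat \<Rightarrow> real mat) \<Rightarrow> real mat" where
  "block_matrix N n F =
     mat (block_offset n (Suc N)) (block_offset n (Suc N))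
       (\<lambda>(r, c). let i = block_index n r; j = block_index n c
                 in F i j $$ (r - block_offset n i, c - block_offset n j))"

definition system_matrix ::
  "nat \<Rightarrow> (nat \<Rightarrow> nat) \<Rightarrow> (nat \<Rightarrow> real mat) \<Rightarrow> (nat \<Rightarrow> real mat) \<Rightarrow> real mat" where
  "system_matrix N n A B = block_matrix N n (\<lambda>i j.
     if i = j then (-1) ^ i \<cdot>\<^sub>m A i
     else if i = Suc j then B i
     else if j = Suc i then (B j)\<^sup>T
     else 0\<^sub>m (n i) (n j))"

definition preconditioner ::
  "nat \<Rightarrow> (nat \<Rightarrow> nat) \<Rightarrow> (nat \<Rightarrow> real mat) \<Rightarrow> (nat \<Rightarrow> real mat) \<Rightarrow> real mat" where
  "preconditioner N n B S = block_matrix N n (\<lambda>i j.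
     if i = j then (-1) ^ i \<cdot>\<^sub>m S i
     else if j = Suc i then (B j)\<^sup>T
     else 0\<^sub>m (n i) (n j))"

definition E_mat :: "(nat \<Rightarrow> real mat) \<Rightarrow> (nat \<Rightarrow> real mat) \<Rightarrow> nat \<Rightarrow> real mat" where
  "E_mat A S k = mat_inv_sqrt (S k) * A k * mat_inv_sqrt (S k)"

text \<open>Used for \<open>k \<ge> 1\<close> only.\<close>
definition R_mat :: "(nat \<Rightarrow> real mat) \<Rightarrow> (nat \<Rightarrow> real mat) \<Rightarrow> nat \<Rightarrow> real mat" where
  "R_mat B S k = mat_inv_sqrt (S k) * B k * mat_inv_sqrt (S (k - 1))"

definition min_eig :: "real mat \<Rightarrow> real" where
  "min_eig M = Min (spectrum M)"

definition max_eig :: "real mat \<Rightarrow> real" where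
  "max_eig M = Max (spectrum M)"

fun V_poly :: "(nat \<Rightarrow> real) \<Rightarrow> (nat \<Rightarrow> real) \<Rightarrow> nat \<Rightarrow> real poly" where
  "V_poly gE gR 0 = 1"
| "V_poly gE gR (Suc 0) = [:- gE 0, 1:]"
| "V_poly gE gR (Suc (Suc k)) =
     [:- gE (Suc k), 1:] * V_poly gE gR (Suc k)
       - [:-1, 1:] * [:gR (Suc k):] * V_poly gE gR k"

definition admissible ::
  "nat \<Rightarrow> (nat \<Rightarrow> real mat) \<Rightarrow> (nat \<Rightarrow> real mat) \<Rightarrow> (nat \<Rightarrow> real mat)
     \<Rightarrow> (nat \<Rightarrow> real) \<Rightarrow> (nat \<Rightarrow> real) \<Rightarrow> bool" where
  "admissible N A B S gE gR \<longleftrightarrow>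
     (\<forall>j \<in> {0..N}. gE j \<in> {min_eig (E_mat A S j) .. max_eig (E_mat A S j)}) \<and>
     (\<forall>j \<in> {1..N}. gR j \<in> {min_eig (R_mat B S j * (R_mat B S j)\<^sup>T) ..
                            max_eig (R_mat B S j * (R_mat B S j)\<^sup>T)})"

definition I_set ::
  "nat \<Rightarrow> (nat \<Rightarrow> real mat) \<Rightarrow> (nat \<Rightarrow> real mat) \<Rightarrow> (nat \<Rightarrow> real mat) \<Rightarrow> nat \<Rightarrow> real set" where
  "I_set N A B S k =
     {l. \<exists>gE gR. admissible N A B S gE gR \<and> poly (V_poly gE gR k) l = 0}"

definition I_le ::
  "nat \<Rightarrow> (nat \<Rightarrow> real mat) \<Rightarrow> (nat \<Rightarrow> real mat) \<Rightarrow> (nat \<Rightarrow> real mat) \<Rightarrow> nat \<Rightarrow> real set" where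
  "I_le N A B S k = (\<Union>j \<in> {1..k}. I_set N A B S j)"

end

theory Submission
  imports Defs
begin

text \<open>
Write the eigenvalue equation as \<open>\<A> u = l \<P> u\<close> and substitute \<open>v_k = S_k^{1/2} u_k\<close>. With the
matrices \<open>E_k\<close> and \<open>R_k\<close> the block rows become
  \<open>(l - E_k) v_k - (-1)^k R_k v_{k-1} = (-1)^{k+1} (l - 1) R_{k+1}^T v_{k+1}\<close>.
Block elimination from the top produces the Schur complements
  \<open>Y_1 = l - E_0\<close>,  \<open>Y_{k+1} = (l - E_k) - (l - 1) R_k Y_k^{-1} R_k^T\<close>,
and the polynomials satisfy the same recurrence in the scalar form
  \<open>V_{k+1} / V_k = (l - gE_k) - (l - 1) gR_k (V_{k-1} / V_k)\<close>.

Suppose that \<open>l\<close> is a root of none of \<open>V_1, ..., V_{N+1}\<close> for any admissible choice of the parameters.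
Then every Rayleigh quotient of \<open>Y_k\<close> is a value of \<open>V_k / V_{k-1}\<close> for some admissible parameters
(\<open>schur_step\<close>, \<open>schur_elimination\<close>). These values form an interval, because the ratio is continuous on
the convex set of parameters (\<open>V_ratios_convex\<close>), and the interval does not contain 0. So \<open>Y_k\<close> is
definite, and the elimination can continue. The induction needs the Rayleigh quotients of \<open>Y_k^{-1}\<close>
as well: by two applications of Cauchy-Schwarz they are inverses of numbers between two Rayleigh
quotients of \<open>Y_k\<close> (\<open>inverse_rayleigh\<close>). At the end \<open>Y_{N+1} v_N = 0\<close> with a definite matrix, so \<open>v_N = 0\<close>,
and back substitution gives \<open>v = 0\<close> (\<open>trivial_solution\<close>), a contradiction to \<open>u \<noteq> 0\<close>.

Two facts about real symmetric matrices are needed to connect this with the definitions: the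
smallest and largest eigenvalues bound the Rayleigh quotient (\<open>rayleigh_spectrum_bounds\<close>), and
positive definite matrices have exactly one positive semi-definite square root (\<open>mat_sqrt_pd\<close>). Both
rest on the fact that the minimum of the Rayleigh quotient is an eigenvalue
(\<open>rayleigh_min_attained\<close>).
\<close>

section \<open>Quadratic forms and the Rayleigh quotient\<close>

lemma sym_form_swap:
  fixes M :: "real mat"
  assumes M: "M \<in> carrier_mat n n" "M\<^sup>T = M" and u: "u \<in> carrier_vec n" and v: "v \<in> carrier_vec n"
  shows "u \<bullet> (M *\<^sub>v v) = v \<bullet> (M *\<^sub>v u)"
  using transpose_vec_mult_scalar[OF M(1) v u] M comm_scalar_prod[of "M *\<^sub>v u" n v] u v
  by (metis mult_mat_vec_carrier)

lemma smult_mat_mult_vec: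
  fixes M :: "real mat"
  assumes "M \<in> carrier_mat nr nc" "v \<in> carrier_vec nc"
  shows "(a \<cdot>\<^sub>m M) *\<^sub>v v = a \<cdot>\<^sub>v (M *\<^sub>v v)"
  using assms by (intro eq_vecI) auto

lemma shifted_mult_vec:
  fixes M :: "real mat"
  assumes M: "M \<in> carrier_mat n n" and v: "v \<in> carrier_vec n"
  shows "(M - s \<cdot>\<^sub>m 1\<^sub>m n) *\<^sub>v v = M *\<^sub>v v - s \<cdot>\<^sub>v v"
proof -
  have "(M - s \<cdot>\<^sub>m 1\<^sub>m n) *\<^sub>v v = M *\<^sub>v v - (s \<cdot>\<^sub>m 1\<^sub>m n) *\<^sub>v v"
    by (rule minus_mult_distrib_mat_vec[OF M _ v]) simp
  thus ?thesis using v by (simp add: smult_mat_mult_vec[of _ n n])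
qed

lemma sq_nonneg: "(v :: real vec) \<bullet> v \<ge> 0"
  by (simp add: scalar_prod_def sum_nonneg)

lemma sq_pos:
  assumes v: "v \<in> carrier_vec n" and nz: "v \<noteq> 0\<^sub>v n"
  shows "(v :: real vec) \<bullet> v > 0"
proof -
  obtain i where i: "i < n" "v $ i \<noteq> 0" using v nz
    by (metis carrier_vecD eq_vecI index_zero_vec(1) index_zero_vec(2))
  have "0 < (\<Sum>i = 0..<n. v $ i * v $ i)"
    by (rule sum_pos2[of _ i]) (use i in \<open>auto simp: zero_less_mult_iff\<close>)
  thus ?thesis using v by (simp add: scalar_prod_def)
qed

lemma form_add_smult:
  fixes M :: "real mat"
  assumes M: "M \<in> carrier_mat n n" "M\<^sup>T = M" and u: "u \<in> carrier_vec n" and v: "v \<in> carrier_vec n"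
  shows "(u + t \<cdot>\<^sub>v v) \<bullet> (M *\<^sub>v (u + t \<cdot>\<^sub>v v))
       = u \<bullet> (M *\<^sub>v u) + 2 * t * (u \<bullet> (M *\<^sub>v v)) + t\<^sup>2 * (v \<bullet> (M *\<^sub>v v))"
proof -
  have tv: "t \<cdot>\<^sub>v v \<in> carrier_vec n" and Mu: "M *\<^sub>v u \<in> carrier_vec n"
    and Mv: "M *\<^sub>v v \<in> carrier_vec n" and tMv: "t \<cdot>\<^sub>v (M *\<^sub>v v) \<in> carrier_vec n"
    using M u v by auto
  have "M *\<^sub>v (u + t \<cdot>\<^sub>v v) = M *\<^sub>v u + t \<cdot>\<^sub>v (M *\<^sub>v v)"
    using mult_add_distrib_mat_vec[OF M(1) u tv] mult_mat_vec[OF M(1) v] by simp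
  hence "(u + t \<cdot>\<^sub>v v) \<bullet> (M *\<^sub>v (u + t \<cdot>\<^sub>v v))
      = (u \<bullet> (M *\<^sub>v u) + t * (u \<bullet> (M *\<^sub>v v))) + t * (v \<bullet> (M *\<^sub>v u) + t * (v \<bullet> (M *\<^sub>v v)))"
    using u v tv Mu Mv tMv
    by (simp add: add_scalar_prod_distrib[OF u tv] scalar_prod_add_distrib[OF u Mu tMv]
        scalar_prod_add_distrib[OF v Mu tMv])
  thus ?thesis using sym_form_swap[OF M u v] by (simp add: algebra_simps power2_eq_square)
qed

text \<open>The usual discriminant argument: the form is nonnegative at \<open>u + t v\<close> for every real \<open>t\<close>.
The form may be degenerate, so the case in which it vanishes at \<open>v\<close> is separate.\<close>

lemma form_cauchy_schwarz:
  assumes Y: "sym_psd n Y" and u: "u \<in> carrier_vec n" and v: "v \<in> carrier_vec n"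
  shows "(u \<bullet> (Y *\<^sub>v v))\<^sup>2 \<le> (u \<bullet> (Y *\<^sub>v u)) * (v \<bullet> (Y *\<^sub>v v))"
proof -
  have M: "Y \<in> carrier_mat n n" "Y\<^sup>T = Y" using Y by (auto simp: sym_psd_def)
  define a b c where "a = u \<bullet> (Y *\<^sub>v u)" "b = u \<bullet> (Y *\<^sub>v v)" "c = v \<bullet> (Y *\<^sub>v v)"
  have nn: "0 \<le> a + 2 * t * b + t\<^sup>2 * c" for t
    using Y u v form_add_smult[OF M u v, of t] unfolding sym_psd_def a_b_c_def
    by (metis add_carrier_vec smult_carrier_vec)
  have c0: "c \<ge> 0" using Y v by (auto simp: sym_psd_def a_b_c_def)
  have "b\<^sup>2 \<le> a * c"
  proof (cases "c = 0")
    case True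
    have "b = 0"
    proof (rule ccontr)
      assume "b \<noteq> 0"
      thus False using nn[of "- (a + 1) / (2 * b)"] True by (simp add: field_simps)
    qed
    thus ?thesis using True by simp
  next
    case False
    hence "c > 0" using c0 by simp
    thus ?thesis using nn[of "- b / c"]
      by (simp add: field_simps power2_eq_square)
  qed
  thus ?thesis by (simp add: a_b_c_def)
qed

lemma sym_psd_one: "sym_psd n (1\<^sub>m n)"
  by (auto simp: sym_psd_def sq_nonneg)

lemma cauchy_schwarz_vec:
  assumes "u \<in> carrier_vec n" "v \<in> carrier_vec n"
  shows "((u :: real vec) \<bullet> v)\<^sup>2 \<le> (u \<bullet> u) * (v \<bullet> v)"
  using form_cauchy_schwarz[OF sym_psd_one assms] assms by simp

lemma mat_vec_bounded:
  fixes M :: "real mat"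
  assumes M: "M \<in> carrier_mat nr nc"
  obtains C where "C > 0" "\<And>v. v \<in> carrier_vec nc \<Longrightarrow> (M *\<^sub>v v) \<bullet> (M *\<^sub>v v) \<le> C * (v \<bullet> v)"
proof
  define C where "C = (\<Sum>i<nr. row M i \<bullet> row M i)"
  have "C \<ge> 0" unfolding C_def by (simp add: sum_nonneg sq_nonneg)
  thus "C + 1 > 0" by simp
  fix v :: "real vec" assume v: "v \<in> carrier_vec nc"
  have "(M *\<^sub>v v) \<bullet> (M *\<^sub>v v) = (\<Sum>i<nr. (row M i \<bullet> v)\<^sup>2)"
    using M by (simp add: scalar_prod_def[of "M *\<^sub>v v"] lessThan_atLeast0 power2_eq_square)
  also have "\<dots> \<le> (\<Sum>i<nr. (row M i \<bullet> row M i) * (v \<bullet> v))"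
    by (rule sum_mono, rule cauchy_schwarz_vec[of _ nc]) (use M v in auto)
  also have "\<dots> = C * (v \<bullet> v)" by (simp add: C_def sum_distrib_right)
  also have "\<dots> \<le> (C + 1) * (v \<bullet> v)" using sq_nonneg[of v] by (simp add: algebra_simps)
  finally show "(M *\<^sub>v v) \<bullet> (M *\<^sub>v v) \<le> (C + 1) * (v \<bullet> v)" .
qed

lemma form_bounded:
  fixes M :: "real mat"
  assumes M: "M \<in> carrier_mat n n"
  obtains C where "C > 0" "\<And>v. v \<in> carrier_vec n \<Longrightarrow> \<bar>v \<bullet> (M *\<^sub>v v)\<bar> \<le> C * (v \<bullet> v)"
proof -
  obtain C where C: "C > 0" "\<And>v. v \<in> carrier_vec n \<Longrightarrow> (M *\<^sub>v v) \<bullet> (M *\<^sub>v v) \<le> C * (v \<bullet> v)"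
    using mat_vec_bounded[OF M] by blast
  have "\<bar>v \<bullet> (M *\<^sub>v v)\<bar> \<le> sqrt C * (v \<bullet> v)" if v: "v \<in> carrier_vec n" for v
  proof -
    have Mv: "M *\<^sub>v v \<in> carrier_vec n" using M v by auto
    have "(v \<bullet> (M *\<^sub>v v))\<^sup>2 \<le> (v \<bullet> v) * (C * (v \<bullet> v))"
      using cauchy_schwarz_vec[OF v Mv] mult_left_mono[OF C(2)[OF v] sq_nonneg[of v]] by linarith
    also have "\<dots> = (sqrt C * (v \<bullet> v))\<^sup>2" using C(1) by (simp add: power2_eq_square)
    finally show ?thesis using C(1) sq_nonneg[of v] by (simp add: abs_le_square_iff[symmetric])
  qed
  thus ?thesis using that[of "sqrt C"] C(1) by simp
qed

lemma mat_inverse_exists: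
  fixes M :: "real mat"
  assumes M: "M \<in> carrier_mat n n"
    and inj: "\<And>v. v \<in> carrier_vec n \<Longrightarrow> M *\<^sub>v v = 0\<^sub>v n \<Longrightarrow> v = 0\<^sub>v n"
  shows "mat_inv M \<in> carrier_mat n n" "M * mat_inv M = 1\<^sub>m n" "mat_inv M * M = 1\<^sub>m n"
proof -
  have "det M \<noteq> 0" using det_0_iff_vec_prod_zero[OF M] inj by blast
  hence "M \<in> Units (ring_mat TYPE(real) n ())" by (rule det_non_zero_imp_unit[OF M])
  then obtain W where "mat_inverse M = Some W"
    using mat_inverse(1)[OF M, where b = "()"] by (cases "mat_inverse M") auto
  thus "mat_inv M \<in> carrier_mat n n" "M * mat_inv M = 1\<^sub>m n" "mat_inv M * M = 1\<^sub>m n"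
    using mat_inverse(2)[OF M] by auto
qed

text \<open>A substitute for compactness of the unit sphere. Cauchy-Schwarz for the form of \<open>Y\<close> bounds
\<open>|Y v|^2\<close> by a multiple of \<open>v . Y v\<close>, and the inverse of \<open>Y\<close> bounds \<open>|v|\<close> by a multiple of \<open>|Y v|\<close>.\<close>

lemma sym_psd_coercive:
  assumes Y: "sym_psd n Y"
    and inj: "\<And>v. v \<in> carrier_vec n \<Longrightarrow> Y *\<^sub>v v = 0\<^sub>v n \<Longrightarrow> v = 0\<^sub>v n"
  obtains d where "d > 0" "\<And>v. v \<in> carrier_vec n \<Longrightarrow> d * (v \<bullet> v) \<le> v \<bullet> (Y *\<^sub>v v)"
proof -
  have Yc: "Y \<in> carrier_mat n n" using Y by (auto simp: sym_psd_def)
  let ?Z = "mat_inv Y"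
  note Z = mat_inverse_exists[OF Yc inj]
  obtain C where C: "C > 0" "\<And>v. v \<in> carrier_vec n \<Longrightarrow> (?Z *\<^sub>v v) \<bullet> (?Z *\<^sub>v v) \<le> C * (v \<bullet> v)"
    using mat_vec_bounded[OF Z(1)] by blast
  obtain K where K: "K > 0" "\<And>v. v \<in> carrier_vec n \<Longrightarrow> \<bar>v \<bullet> (Y *\<^sub>v v)\<bar> \<le> K * (v \<bullet> v)"
    using form_bounded[OF Yc] by blast
  have "1 / (C * K) * (v \<bullet> v) \<le> v \<bullet> (Y *\<^sub>v v)" if v: "v \<in> carrier_vec n" for v
  proof -
    let ?y = "Y *\<^sub>v v" and ?p = "v \<bullet> (Y *\<^sub>v v)"
    have y: "?y \<in> carrier_vec n" using Yc v by auto
    have p0: "?p \<ge> 0" using Y v by (auto simp: sym_psd_def)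
    have "?Z *\<^sub>v ?y = v" using assoc_mult_mat_vec[OF Z(1) Yc v] Z(3) v by simp
    hence 1: "v \<bullet> v \<le> C * (?y \<bullet> ?y)" using C(2)[OF y] by simp
    have "(?y \<bullet> ?y)\<^sup>2 \<le> (?y \<bullet> (Y *\<^sub>v ?y)) * ?p" by (rule form_cauchy_schwarz[OF Y y v])
    also have "\<dots> \<le> (K * (?y \<bullet> ?y)) * ?p" using K(2)[OF y] p0 by (intro mult_right_mono) auto
    finally have "(?y \<bullet> ?y) * (?y \<bullet> ?y) \<le> (?y \<bullet> ?y) * (K * ?p)"
      by (simp add: power2_eq_square ac_simps)
    hence 2: "?y \<bullet> ?y \<le> K * ?p"
      using sq_nonneg[of ?y] K(1) p0 by (cases "?y \<bullet> ?y = 0") auto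
    have "v \<bullet> v \<le> C * (K * ?p)" using 1 mult_left_mono[OF 2, of C] C(1) by linarith
    thus ?thesis using C(1) K(1) by (simp add: field_simps)
  qed
  thus ?thesis using that[of "1 / (C * K)"] C(1) K(1) by simp
qed

text \<open>Let \<open>s\<close> be the largest number such that \<open>M - s\<close> is positive semi-definite. If \<open>M - s\<close> were
injective, it would be coercive and \<open>s\<close> could be increased; so it has a kernel, and a kernel
vector is an eigenvector at which the Rayleigh quotient is minimal.\<close>

lemma rayleigh_min_attained:
  fixes M :: "real mat"
  assumes M: "M \<in> carrier_mat n n" "M\<^sup>T = M" and n: "n \<ge> 1"
  obtains s v where "v \<in> carrier_vec n" "v \<noteq> 0\<^sub>v n" "M *\<^sub>v v = s \<cdot>\<^sub>v v"
    "\<And>w. w \<in> carrier_vec n \<Longrightarrow> s * (w \<bullet> w) \<le> w \<bullet> (M *\<^sub>v w)"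
proof -
  define L where "L = {s. \<forall>w \<in> carrier_vec n. s * (w \<bullet> w) \<le> w \<bullet> (M *\<^sub>v w)}"
  obtain C where C: "C > 0" "\<And>v. v \<in> carrier_vec n \<Longrightarrow> \<bar>v \<bullet> (M *\<^sub>v v)\<bar> \<le> C * (v \<bullet> v)"
    using form_bounded[OF M(1)] by blast
  have "- C \<in> L" unfolding L_def using C(2) by (auto simp: abs_le_iff) (metis neg_le_iff_le minus_minus)
  hence ne: "L \<noteq> {}" by auto
  have bdd: "bdd_above L"
  proof
    fix s assume "s \<in> L"
    moreover have "unit_vec n 0 \<in> carrier_vec n" by simp
    ultimately have "s * (unit_vec n 0 \<bullet> unit_vec n 0) \<le> unit_vec n 0 \<bullet> (M *\<^sub>v unit_vec n 0)"
      unfolding L_def by blast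
    thus "s \<le> unit_vec n 0 \<bullet> (M *\<^sub>v unit_vec n 0)" using n by simp
  qed
  define s where "s = Sup L"
  have sL: "s * (w \<bullet> w) \<le> w \<bullet> (M *\<^sub>v w)" if w: "w \<in> carrier_vec n" for w
  proof (cases "w = 0\<^sub>v n")
    case True
    thus ?thesis using M(1) by simp
  next
    case False
    have p: "w \<bullet> w > 0" by (rule sq_pos[OF w False])
    have "s \<le> (w \<bullet> (M *\<^sub>v w)) / (w \<bullet> w)"
      unfolding s_def by (rule cSup_least[OF ne]) (use p w in \<open>auto simp: L_def field_simps\<close>)
    thus ?thesis using p by (simp add: field_simps)
  qed
  let ?Y = "M - s \<cdot>\<^sub>m 1\<^sub>m n"
  have Yc: "?Y \<in> carrier_mat n n" using M by auto
  have Yv: "?Y *\<^sub>v v = M *\<^sub>v v - s \<cdot>\<^sub>v v" if "v \<in> carrier_vec n" for v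
    by (rule shifted_mult_vec[OF M(1) that])
  have form: "v \<bullet> (?Y *\<^sub>v v) = v \<bullet> (M *\<^sub>v v) - s * (v \<bullet> v)" if v: "v \<in> carrier_vec n" for v
    using scalar_prod_minus_distrib[of v n "M *\<^sub>v v" "s \<cdot>\<^sub>v v"] v M(1) Yv[OF v] by simp
  have YT: "?Y\<^sup>T = ?Y" using M
    by (subst transpose_minus[of _ n n]) (auto intro!: eq_matI)
  have Ypsd: "sym_psd n ?Y" unfolding sym_psd_def using Yc YT form sL by auto
  have "\<exists>v \<in> carrier_vec n. ?Y *\<^sub>v v = 0\<^sub>v n \<and> v \<noteq> 0\<^sub>v n"
  proof (rule ccontr)
    assume "\<not> ?thesis"
    then obtain d where d: "d > 0" "\<And>v. v \<in> carrier_vec n \<Longrightarrow> d * (v \<bullet> v) \<le> v \<bullet> (?Y *\<^sub>v v)"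
      using sym_psd_coercive[OF Ypsd] by blast
    have "s + d \<in> L" unfolding L_def using d(2) form by (fastforce simp: algebra_simps)
    hence "s + d \<le> s" unfolding s_def by (rule cSup_upper[OF _ bdd])
    thus False using d(1) by simp
  qed
  then obtain v where v: "v \<in> carrier_vec n" "v \<noteq> 0\<^sub>v n" "M *\<^sub>v v - s \<cdot>\<^sub>v v = 0\<^sub>v n"
    using Yv by auto
  have "M *\<^sub>v v = s \<cdot>\<^sub>v v"
  proof (rule eq_vecI)
    fix i assume "i < dim_vec (s \<cdot>\<^sub>v v)"
    hence i: "i < n" using v by simp
    hence "(M *\<^sub>v v - s \<cdot>\<^sub>v v) $ i = 0" using v(3) by simp
    thus "(M *\<^sub>v v) $ i = (s \<cdot>\<^sub>v v) $ i" using i v(1) M(1) by simp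
  qed (use v M in auto)
  thus ?thesis using that v sL by blast
qed

lemma rayleigh_max_attained:
  fixes M :: "real mat"
  assumes M: "M \<in> carrier_mat n n" "M\<^sup>T = M" and n: "n \<ge> 1"
  obtains s v where "v \<in> carrier_vec n" "v \<noteq> 0\<^sub>v n" "M *\<^sub>v v = s \<cdot>\<^sub>v v"
    "\<And>w. w \<in> carrier_vec n \<Longrightarrow> w \<bullet> (M *\<^sub>v w) \<le> s * (w \<bullet> w)"
proof -
  have "- M \<in> carrier_mat n n" "(- M)\<^sup>T = - M" using M by (auto simp: transpose_uminus)
  then obtain s v where v: "v \<in> carrier_vec n" "v \<noteq> 0\<^sub>v n" "(- M) *\<^sub>v v = s \<cdot>\<^sub>v v"
    and b: "\<And>w. w \<in> carrier_vec n \<Longrightarrow> s * (w \<bullet> w) \<le> w \<bullet> ((- M) *\<^sub>v w)"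
    using rayleigh_min_attained[OF _ _ n] by metis
  have "M *\<^sub>v v = - ((- M) *\<^sub>v v)" using v(1) M by simp
  also have "\<dots> = (- s) \<cdot>\<^sub>v v" unfolding v(3) by (intro eq_vecI) auto
  finally have e: "M *\<^sub>v v = (- s) \<cdot>\<^sub>v v" .
  have "w \<bullet> (M *\<^sub>v w) \<le> (- s) * (w \<bullet> w)" if w: "w \<in> carrier_vec n" for w
    using b[OF w] w M by simp
  thus ?thesis using that v(1,2) e by blast
qed

text \<open>The extreme eigenvalues are defined as extrema of the finite set of all eigenvalues; here they
are identified with the extrema of the Rayleigh quotient, which are eigenvalues by the two
previous lemmas.\<close>

lemma rayleigh_spectrum_bounds:
  fixes M :: "real mat"
  assumes M: "M \<in> carrier_mat n n" "M\<^sup>T = M" and n: "n \<ge> 1"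
  shows "w \<in> carrier_vec n \<Longrightarrow> min_eig M * (w \<bullet> w) \<le> w \<bullet> (M *\<^sub>v w)"
    and "w \<in> carrier_vec n \<Longrightarrow> w \<bullet> (M *\<^sub>v w) \<le> max_eig M * (w \<bullet> w)"
    and "min_eig M \<le> max_eig M"
proof -
  have fin: "finite (spectrum M)" using card_finite_spectrum[OF M(1)] by simp
  have inS: "s \<in> spectrum M"
    if "v \<in> carrier_vec n" "v \<noteq> 0\<^sub>v n" "M *\<^sub>v v = s \<cdot>\<^sub>v v" for s v
    using that M(1) by (auto simp: spectrum_def eigenvalue_def eigenvector_def)
  have eig: "\<exists>v. v \<in> carrier_vec n \<and> v \<bullet> v > 0 \<and> v \<bullet> (M *\<^sub>v v) = e * (v \<bullet> v)"
    if e: "e \<in> spectrum M" for e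
  proof -
    obtain v where v: "v \<in> carrier_vec n" "v \<noteq> 0\<^sub>v n" "M *\<^sub>v v = e \<cdot>\<^sub>v v"
      using e M(1) by (auto simp: spectrum_def eigenvalue_def eigenvector_def)
    thus ?thesis using sq_pos by force
  qed
  obtain s v where s: "v \<in> carrier_vec n" "v \<noteq> 0\<^sub>v n" "M *\<^sub>v v = s \<cdot>\<^sub>v v"
    "\<And>w. w \<in> carrier_vec n \<Longrightarrow> s * (w \<bullet> w) \<le> w \<bullet> (M *\<^sub>v w)"
    using rayleigh_min_attained[OF M n] by metis
  have "min_eig M = s" unfolding min_eig_def
  proof (rule Min_eqI[OF fin _ inS[OF s(1-3)]])
    fix e assume "e \<in> spectrum M"
    then obtain x where "x \<in> carrier_vec n" "x \<bullet> x > 0" "x \<bullet> (M *\<^sub>v x) = e * (x \<bullet> x)"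
      using eig by blast
    thus "s \<le> e" using s(4)[of x] by simp
  qed
  thus "w \<in> carrier_vec n \<Longrightarrow> min_eig M * (w \<bullet> w) \<le> w \<bullet> (M *\<^sub>v w)" using s(4) by simp
  obtain t u where t: "u \<in> carrier_vec n" "u \<noteq> 0\<^sub>v n" "M *\<^sub>v u = t \<cdot>\<^sub>v u"
    "\<And>w. w \<in> carrier_vec n \<Longrightarrow> w \<bullet> (M *\<^sub>v w) \<le> t * (w \<bullet> w)"
    using rayleigh_max_attained[OF M n] by metis
  have "max_eig M = t" unfolding max_eig_def
  proof (rule Max_eqI[OF fin _ inS[OF t(1-3)]])
    fix e assume "e \<in> spectrum M"
    then obtain x where "x \<in> carrier_vec n" "x \<bullet> x > 0" "x \<bullet> (M *\<^sub>v x) = e * (x \<bullet> x)"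
      using eig by blast
    thus "e \<le> t" using t(4)[of x] by simp
  qed
  thus "w \<in> carrier_vec n \<Longrightarrow> w \<bullet> (M *\<^sub>v w) \<le> max_eig M * (w \<bullet> w)" using t(4) by simp
  show "min_eig M \<le> max_eig M" unfolding min_eig_def max_eig_def
    using Min_le[OF fin inS[OF s(1-3)]] Max_ge[OF fin inS[OF s(1-3)]] by linarith
qed

section \<open>The square root of a positive definite matrix\<close>

text \<open>The square matrix with rows \<open>x_0, ..., x_{k-1}\<close> and \<open>n - k\<close> zero rows is singular.\<close>

lemma exists_orthogonal_vec:
  fixes x :: "nat \<Rightarrow> real vec"
  assumes x: "\<And>i. i < k \<Longrightarrow> x i \<in> carrier_vec n" and k: "k < n"
  obtains y where "y \<in> carrier_vec n" "y \<noteq> 0\<^sub>v n" "\<And>i. i < k \<Longrightarrow> x i \<bullet> y = 0"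
proof -
  let ?G = "mat n n (\<lambda>(i, j). if i < k then x i $ j else 0)"
  have G: "?G \<in> carrier_mat n n" by simp
  have "?G\<^sup>T *\<^sub>v unit_vec n k = 0\<^sub>v n"
    using k by (intro eq_vecI) (auto simp: scalar_prod_right_unit)
  moreover have "unit_vec n k \<noteq> (0\<^sub>v n :: real vec)" using k by simp
  ultimately have "det ?G\<^sup>T = 0"
    using det_0_iff_vec_prod_zero[of "?G\<^sup>T" n] G unit_vec_carrier transpose_carrier_mat by blast
  hence "det ?G = 0" using det_transpose[OF G] by simp
  then obtain y where y: "y \<in> carrier_vec n" "y \<noteq> 0\<^sub>v n" "?G *\<^sub>v y = 0\<^sub>v n"
    using det_0_iff_vec_prod_zero[OF G] by blast
  have "x i \<bullet> y = 0" if i: "i < k" for i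
  proof -
    have "row ?G i = x i" using i k x[OF i] by (intro eq_vecI) auto
    moreover have "(?G *\<^sub>v y) $ i = 0" using y(3) i k by simp
    ultimately show ?thesis using i k by simp
  qed
  thus ?thesis using that y(1,2) by blast
qed

text \<open>Deflation. Adding \<open>c * sum_i x_i x_i^T\<close> moves the eigenvalues of the known eigenvectors \<open>x_i\<close> up
to \<open>e_i + c\<close> and changes nothing on their orthogonal complement. For large \<open>c\<close> the minimum of the
Rayleigh quotient is below all \<open>e_i + c\<close>, so a minimal eigenvector is orthogonal to every \<open>x_i\<close>
and is an eigenvector of \<open>M\<close> itself.\<close>

lemma orthonormal_eigenvectors:
  fixes M :: "real mat"
  assumes M: "M \<in> carrier_mat n n" "M\<^sup>T = M" and "k \<le> n"
  shows "\<exists>x e. (\<forall>i<k. x i \<in> carrier_vec n \<and> M *\<^sub>v x i = e i \<cdot>\<^sub>v x i) \<and>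
    (\<forall>i<k. \<forall>j<k. x i \<bullet> x j = (if i = j then 1 else 0))"
  using \<open>k \<le> n\<close>
proof (induction k)
  case 0
  show ?case by simp
next
  case (Suc k)
  then obtain x e where xe: "\<forall>i<k. x i \<in> carrier_vec n \<and> M *\<^sub>v x i = e i \<cdot>\<^sub>v x i"
    "\<forall>i<k. \<forall>j<k. x i \<bullet> x j = (if i = j then 1 else 0)"
    using Suc_leD by blast
  hence x: "\<And>i. i < k \<Longrightarrow> x i \<in> carrier_vec n"
    and ev: "\<And>i. i < k \<Longrightarrow> M *\<^sub>v x i = e i \<cdot>\<^sub>v x i"
    and on: "\<And>i j. i < k \<Longrightarrow> j < k \<Longrightarrow> x i \<bullet> x j = (if i = j then 1 else 0)"
    by blast+
  obtain C where C: "C > 0" "\<And>v. v \<in> carrier_vec n \<Longrightarrow> \<bar>v \<bullet> (M *\<^sub>v v)\<bar> \<le> C * (v \<bullet> v)"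
    using form_bounded[OF M(1)] by blast
  (* all e i are at least -C, so that e i + c exceeds the bound C of the Rayleigh quotient of M *)
  define c where "c = 2 * C + 1"
  define D where "D = mat n n (\<lambda>(a, b). c * (\<Sum>i<k. x i $ a * x i $ b))"
  let ?M = "M + D"
  have D: "D \<in> carrier_mat n n" by (simp add: D_def)
  have M': "?M \<in> carrier_mat n n" using M D by simp
  have "D\<^sup>T = D" by (intro eq_matI) (auto simp: D_def mult.commute)
  hence MT: "?M\<^sup>T = ?M" using transpose_add[OF M(1) D] M(2) by simp
  have mult: "?M *\<^sub>v w = M *\<^sub>v w + vec n (\<lambda>a. c * (\<Sum>i<k. x i $ a * (x i \<bullet> w)))"
    if w: "w \<in> carrier_vec n" for w
  proof -
    have "D *\<^sub>v w = vec n (\<lambda>a. c * (\<Sum>i<k. x i $ a * (x i \<bullet> w)))"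
    proof (rule eq_vecI)
      fix a assume "a < dim_vec (vec n (\<lambda>a. c * (\<Sum>i<k. x i $ a * (x i \<bullet> w))))"
      hence a: "a < n" by simp
      have "(D *\<^sub>v w) $ a = (\<Sum>b = 0..<n. c * (\<Sum>i<k. x i $ a * x i $ b) * w $ b)"
        using a w by (simp add: D_def scalar_prod_def)
      also have "\<dots> = (\<Sum>b = 0..<n. \<Sum>i<k. c * (x i $ a * (x i $ b * w $ b)))"
        by (simp add: sum_distrib_left sum_distrib_right mult.assoc)
      also have "\<dots> = (\<Sum>i<k. \<Sum>b = 0..<n. c * (x i $ a * (x i $ b * w $ b)))"
        by (rule sum.swap)
      also have "\<dots> = c * (\<Sum>i<k. x i $ a * (x i \<bullet> w))"
        using w by (simp add: scalar_prod_def sum_distrib_left)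
      finally show "(D *\<^sub>v w) $ a = vec n (\<lambda>a. c * (\<Sum>i<k. x i $ a * (x i \<bullet> w))) $ a"
        using a by simp
    qed (simp add: D_def)
    thus ?thesis using add_mult_distrib_mat_vec[OF M(1) D w] by simp
  qed
  have orth: "?M *\<^sub>v w = M *\<^sub>v w" if w: "w \<in> carrier_vec n" "\<And>i. i < k \<Longrightarrow> x i \<bullet> w = 0" for w
    unfolding mult[OF w(1)] using w M(1) by (intro eq_vecI) auto
  have ev': "?M *\<^sub>v x j = (e j + c) \<cdot>\<^sub>v x j" if j: "j < k" for j
  proof -
    have "(\<Sum>i<k. x i $ a * (x i \<bullet> x j)) = x j $ a" for a
    proof -
      have "(\<Sum>i<k. x i $ a * (x i \<bullet> x j)) = (\<Sum>i<k. if i = j then x i $ a else 0)"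
        by (rule sum.cong) (use on j in auto)
      thus ?thesis using j by simp
    qed
    thus ?thesis unfolding mult[OF x[OF j]] ev[OF j]
      using x[OF j] by (intro eq_vecI) (auto simp: algebra_simps)
  qed
  have eC: "e j \<ge> - C" if j: "j < k" for j
    using C(2)[OF x[OF j]] ev[OF j] x[OF j] on[OF j j] by simp
  have "n \<ge> 1" using Suc.prems by simp
  then obtain s z where z: "z \<in> carrier_vec n" "z \<noteq> 0\<^sub>v n" "?M *\<^sub>v z = s \<cdot>\<^sub>v z"
    and min: "\<And>w. w \<in> carrier_vec n \<Longrightarrow> s * (w \<bullet> w) \<le> w \<bullet> (?M *\<^sub>v w)"
    using rayleigh_min_attained[OF M' MT] by blast
  have "s \<le> C"
  proof -
    obtain y where y: "y \<in> carrier_vec n" "y \<noteq> 0\<^sub>v n" "\<And>i. i < k \<Longrightarrow> x i \<bullet> y = 0"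
      using exists_orthogonal_vec[of k x n] x Suc.prems by auto
    have "s * (y \<bullet> y) \<le> C * (y \<bullet> y)"
      using min[OF y(1)] orth[OF y(1,3)] C(2)[OF y(1)] by simp
    thus ?thesis using sq_pos[OF y(1,2)] by simp
  qed
  have zo: "x j \<bullet> z = 0" if j: "j < k" for j
  proof -
    have "s * (x j \<bullet> z) = (e j + c) * (x j \<bullet> z)"
      using sym_form_swap[OF M' MT x[OF j] z(1)] z ev'[OF j] x[OF j]
        comm_scalar_prod[OF x[OF j] z(1)] by simp
    moreover have "s \<noteq> e j + c" using \<open>s \<le> C\<close> eC[OF j] C(1) by (simp add: c_def)
    ultimately show ?thesis by simp
  qed
  have Mz: "M *\<^sub>v z = s \<cdot>\<^sub>v z" using orth[OF z(1) zo] z(3) by simp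
  define r where "r = 1 / sqrt (z \<bullet> z)"
  have rr: "r * r * (z \<bullet> z) = 1" using sq_pos[OF z(1,2)] by (simp add: r_def)
  let ?x = "x(k := r \<cdot>\<^sub>v z)" and ?e = "e(k := s)"
  have "?x i \<in> carrier_vec n \<and> M *\<^sub>v ?x i = ?e i \<cdot>\<^sub>v ?x i" if "i < Suc k" for i
    using that x ev z(1) Mz mult_mat_vec[OF M(1) z(1)]
    by (cases "i = k") (auto simp: smult_smult_assoc mult.commute)
  moreover have "?x i \<bullet> ?x j = (if i = j then 1 else 0)" if "i < Suc k" "j < Suc k" for i j
    using that x z(1) on zo comm_scalar_prod[OF x z(1)] rr
    by (cases "i = k"; cases "j = k") (auto simp: mult.assoc)
  ultimately show ?case by blast
qed

text \<open>With an orthogonal matrix \<open>P\<close> of eigenvectors and \<open>M = P D P^T\<close>, take \<open>P sqrt(D) P^T\<close>.\<close>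

lemma psd_sqrt_exists:
  assumes M: "sym_psd n M"
  shows "\<exists>Q. sym_psd n Q \<and> Q * Q = M"
proof -
  have Mc: "M \<in> carrier_mat n n" "M\<^sup>T = M" using M by (auto simp: sym_psd_def)
  obtain x e where xe: "\<forall>i<n. x i \<in> carrier_vec n \<and> M *\<^sub>v x i = e i \<cdot>\<^sub>v x i"
    "\<forall>i<n. \<forall>j<n. x i \<bullet> x j = (if i = j then 1 else 0)"
    using orthonormal_eigenvectors[OF Mc le_refl] by blast
  hence x: "\<And>i. i < n \<Longrightarrow> x i \<in> carrier_vec n"
    and ev: "\<And>i. i < n \<Longrightarrow> M *\<^sub>v x i = e i \<cdot>\<^sub>v x i"
    and on: "\<And>i j. i < n \<Longrightarrow> j < n \<Longrightarrow> x i \<bullet> x j = (if i = j then 1 else 0)"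
    by blast+
  define P where "P = mat n n (\<lambda>(a, i). x i $ a)"
  have P: "P \<in> carrier_mat n n" and PT: "P\<^sup>T \<in> carrier_mat n n" by (auto simp: P_def)
  have colP: "col P i = x i" if "i < n" for i
    using that x[OF that] by (intro eq_vecI) (auto simp: P_def)
  have PTP: "P\<^sup>T * P = 1\<^sub>m n"
    by (rule eq_matI) (use P on in \<open>auto simp: colP\<close>)
  have PPT: "P * P\<^sup>T = 1\<^sub>m n" by (rule mat_mult_left_right_inverse[OF PT P PTP])
  have e0: "e i \<ge> 0" if i: "i < n" for i
    using M x[OF i] ev[OF i] on[OF i i] unfolding sym_psd_def by fastforce
  define D where "D = mat_diag n (\<lambda>i. sqrt (e i))"
  have D: "D \<in> carrier_mat n n" and DT: "D\<^sup>T = D"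
    by (auto simp: D_def mat_diag_def intro!: eq_matI)
  have DD: "D * D = mat_diag n e"
    unfolding D_def mat_diag_diag using e0 by (auto simp: mat_diag_def intro!: eq_matI)
  have MP: "M * P = P * mat_diag n e"
  proof (rule eq_matI)
    fix a i assume "a < dim_row (P * mat_diag n e)" "i < dim_col (P * mat_diag n e)"
    hence a: "a < n" and i: "i < n" using P by (auto simp: mat_diag_def)
    have "(M * P) $$ (a, i) = (M *\<^sub>v x i) $ a" using a i Mc P colP[OF i] by simp
    also have "\<dots> = e i * x i $ a" using ev[OF i] x[OF i] a by simp
    finally show "(M * P) $$ (a, i) = (P * mat_diag n e) $$ (a, i)"
      using a i by (simp add: mat_diag_mult_right[OF P]) (simp add: P_def)
  qed (use Mc P in \<open>auto simp: mat_diag_def\<close>)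
  let ?Q = "P * D * P\<^sup>T"
  have Q: "?Q \<in> carrier_mat n n" using P D by simp
  have "?Q * ?Q = P * D * (P\<^sup>T * P) * D * P\<^sup>T"
    using P D PT by (simp add: assoc_mult_mat[of _ n n _ n _ n])
  also have "\<dots> = P * (D * D) * P\<^sup>T"
    using P D PT by (simp add: PTP assoc_mult_mat[of _ n n _ n _ n])
  also have "\<dots> = M * (P * P\<^sup>T)"
    using P PT Mc by (simp add: DD MP[symmetric] assoc_mult_mat[of _ n n _ n _ n])
  finally have QQ: "?Q * ?Q = M" using Mc by (simp add: PPT)
  have QT: "?Q\<^sup>T = ?Q"
    using P D PT DT by (simp add: transpose_mult[of _ n n _ n] assoc_mult_mat[of _ n n _ n _ n])
  have "v \<bullet> (?Q *\<^sub>v v) \<ge> 0" if v: "v \<in> carrier_vec n" for v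
  proof -
    let ?w = "P\<^sup>T *\<^sub>v v"
    have w: "?w \<in> carrier_vec n" and Dw: "D *\<^sub>v ?w \<in> carrier_vec n" using PT D v by auto
    have "v \<bullet> (?Q *\<^sub>v v) = v \<bullet> (P *\<^sub>v (D *\<^sub>v ?w))"
      using P D PT v by (simp add: assoc_mult_mat_vec[of _ n n _ n])
    also have "\<dots> = ?w \<bullet> (D *\<^sub>v ?w)" by (rule transpose_vec_mult_scalar[OF P Dw v, symmetric])
    also have "D *\<^sub>v ?w = vec n (\<lambda>i. sqrt (e i) * ?w $ i)"
    proof (rule eq_vecI)
      fix i assume "i < dim_vec (vec n (\<lambda>i. sqrt (e i) * ?w $ i))"
      hence i: "i < n" by simp
      have "row D i = sqrt (e i) \<cdot>\<^sub>v unit_vec n i"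
        using i by (intro eq_vecI) (auto simp: D_def mat_diag_def)
      hence "(D *\<^sub>v ?w) $ i = (sqrt (e i) \<cdot>\<^sub>v unit_vec n i) \<bullet> ?w" using i D by simp
      also have "\<dots> = sqrt (e i) * (unit_vec n i \<bullet> ?w)"
        by (rule smult_scalar_prod_distrib[OF unit_vec_carrier w])
      also have "unit_vec n i \<bullet> ?w = ?w $ i" by (rule scalar_prod_left_unit[OF w i])
      finally show "(D *\<^sub>v ?w) $ i = vec n (\<lambda>i. sqrt (e i) * ?w $ i) $ i" using i by simp
    qed (use D in simp)
    also have "?w \<bullet> \<dots> \<ge> 0"
      unfolding scalar_prod_def using e0 w
      by (auto intro!: sum_nonneg simp: mult.left_commute simp del: index_mult_mat_vec)
    finally show ?thesis .
  qed
  hence "sym_psd n ?Q" using Q QT by (simp add: sym_psd_def)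
  thus ?thesis using QQ by blast
qed

lemma pd_imp_psd: "sym_pd n M \<Longrightarrow> sym_psd n M"
  unfolding sym_pd_def sym_psd_def by (metis less_eq_real_def mult_mat_vec_carrier scalar_prod_left_zero)

lemma sym_pd_inj: "sym_pd n M \<Longrightarrow> v \<in> carrier_vec n \<Longrightarrow> M *\<^sub>v v = 0\<^sub>v n \<Longrightarrow> v = 0\<^sub>v n"
  unfolding sym_pd_def by (metis less_irrefl scalar_prod_right_zero)

lemma inverse_of_symmetric:
  fixes Y Z :: "real mat"
  assumes Y: "Y \<in> carrier_mat n n" "Y\<^sup>T = Y" and Z: "Z \<in> carrier_mat n n" "Y * Z = 1\<^sub>m n"
  shows "Z\<^sup>T = Z"
proof -
  have ZT: "Z\<^sup>T \<in> carrier_mat n n" using Z by simp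
  have "Z\<^sup>T * Y = 1\<^sub>m n" using transpose_mult[OF Y(1) Z(1)] Z(2) Y(2) by simp
  hence "Z\<^sup>T * Y * Z = Z" using Z by simp
  moreover have "Z\<^sup>T * Y * Z = Z\<^sup>T" using assoc_mult_mat[OF ZT Y(1) Z(1)] Z(2) ZT by simp
  ultimately show ?thesis by simp
qed

lemma psd_form_zero:
  assumes Q: "sym_psd n Q" and v: "v \<in> carrier_vec n" and 0: "v \<bullet> (Q *\<^sub>v v) = 0"
  shows "Q *\<^sub>v v = 0\<^sub>v n"
proof -
  have Qv: "Q *\<^sub>v v \<in> carrier_vec n" using Q v by (auto simp: sym_psd_def)
  have "((Q *\<^sub>v v) \<bullet> (Q *\<^sub>v v))\<^sup>2 \<le> 0" using form_cauchy_schwarz[OF Q Qv v] 0 by simp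
  thus ?thesis using sq_pos[OF Qv] by force
qed

lemma mat_eqI_mult_vec:
  fixes A B :: "real mat"
  assumes A: "A \<in> carrier_mat n m" and B: "B \<in> carrier_mat n m"
    and eq: "\<And>v. v \<in> carrier_vec m \<Longrightarrow> A *\<^sub>v v = B *\<^sub>v v"
  shows "A = B"
proof (rule eq_matI)
  fix i j assume "i < dim_row B" "j < dim_col B"
  hence ij: "i < n" "j < m" using B by auto
  have "(A *\<^sub>v unit_vec m j) $ i = (B *\<^sub>v unit_vec m j) $ i" using eq[of "unit_vec m j"] by simp
  thus "A $$ (i, j) = B $$ (i, j)" using ij A B by simp
qed (use A B in auto)

text \<open>For an eigenvector \<open>x\<close> of \<open>X = Q - T\<close> with eigenvalue \<open>s\<close>, the identity
\<open>(Q x - T x) . (Q x + T x) = |Q x|^2 - |T x|^2 = 0\<close> gives \<open>s (x . Q x + x . T x) = 0\<close>. Both summands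
are nonnegative and the first is not zero because \<open>Q^2\<close> is definite, so \<open>s = 0\<close>. Hence the
Rayleigh quotient of the symmetric matrix \<open>X\<close> vanishes and so does \<open>X\<close>.\<close>

lemma pd_sqrt_unique:
  assumes n: "n \<ge> 1" and M: "sym_pd n M"
    and Q: "sym_psd n Q" "Q * Q = M" and T: "sym_psd n T" "T * T = M"
  shows "Q = T"
proof -
  have Qc: "Q \<in> carrier_mat n n" "Q\<^sup>T = Q" and Tc: "T \<in> carrier_mat n n" "T\<^sup>T = T"
    using Q T by (auto simp: sym_psd_def)
  let ?X = "Q - T"
  have X: "?X \<in> carrier_mat n n" "?X\<^sup>T = ?X"
    using Qc Tc by (auto simp: transpose_minus[OF Qc(1) Tc(1)])
  have Xv: "?X *\<^sub>v v = Q *\<^sub>v v - T *\<^sub>v v" if "v \<in> carrier_vec n" for v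
    by (rule minus_mult_distrib_mat_vec[OF Qc(1) Tc(1) that])
  have sq: "(S *\<^sub>v x) \<bullet> (S *\<^sub>v x) = x \<bullet> (M *\<^sub>v x)"
    if "S \<in> carrier_mat n n" "S\<^sup>T = S" "S * S = M" "x \<in> carrier_vec n" for S x
    using transpose_vec_mult_scalar[of S n n "S *\<^sub>v x" x] that assoc_mult_mat_vec[of S n n S n x]
    by simp
  have eig0: "s = 0" if x: "x \<in> carrier_vec n" "x \<noteq> 0\<^sub>v n" and ev: "?X *\<^sub>v x = s \<cdot>\<^sub>v x" for s x
  proof (rule ccontr)
    assume s: "s \<noteq> 0"
    let ?q = "Q *\<^sub>v x" and ?t = "T *\<^sub>v x"
    have q: "?q \<in> carrier_vec n" and t: "?t \<in> carrier_vec n" using Qc Tc x by auto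
    have "(?q - ?t) \<bullet> (?q + ?t) = ?q \<bullet> ?q - ?t \<bullet> ?t"
      using q t by (simp add: minus_scalar_prod_distrib[of _ n] scalar_prod_add_distrib[of _ n]
          comm_scalar_prod[of ?t n ?q])
    also have "\<dots> = 0" using sq[OF Qc Q(2) x(1)] sq[OF Tc T(2) x(1)] by simp
    also have "?q - ?t = s \<cdot>\<^sub>v x" using Xv[OF x(1)] ev by simp
    finally have "s * (x \<bullet> ?q + x \<bullet> ?t) = 0"
      using x(1) q t by (simp add: scalar_prod_add_distrib[OF x(1) q t])
    hence "x \<bullet> ?q + x \<bullet> ?t = 0" using s by simp
    moreover have "x \<bullet> ?q \<ge> 0" "x \<bullet> ?t \<ge> 0" using Q T x(1) by (auto simp: sym_psd_def)
    ultimately have "x \<bullet> ?q = 0" by simp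
    hence "?q = 0\<^sub>v n" by (rule psd_form_zero[OF Q(1) x(1)])
    hence "x \<bullet> (M *\<^sub>v x) = 0" using sq[OF Qc Q(2) x(1)] by simp
    moreover have "x \<bullet> (M *\<^sub>v x) > 0" using M x by (simp add: sym_pd_def)
    ultimately show False by simp
  qed
  obtain s y where "y \<in> carrier_vec n" "y \<noteq> 0\<^sub>v n" "?X *\<^sub>v y = s \<cdot>\<^sub>v y"
    and smin: "\<And>w. w \<in> carrier_vec n \<Longrightarrow> s * (w \<bullet> w) \<le> w \<bullet> (?X *\<^sub>v w)"
    using rayleigh_min_attained[OF X n] by blast
  hence "s = 0" using eig0 by blast
  hence "w \<bullet> (?X *\<^sub>v w) \<ge> 0" if "w \<in> carrier_vec n" for w
    using smin[OF that] by simp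
  hence Xpsd: "sym_psd n ?X" using X by (simp add: sym_psd_def)
  obtain t z where "z \<in> carrier_vec n" "z \<noteq> 0\<^sub>v n" "?X *\<^sub>v z = t \<cdot>\<^sub>v z"
    and tmax: "\<And>w. w \<in> carrier_vec n \<Longrightarrow> w \<bullet> (?X *\<^sub>v w) \<le> t * (w \<bullet> w)"
    using rayleigh_max_attained[OF X n] by blast
  hence "t = 0" using eig0 by blast
  hence "w \<bullet> (?X *\<^sub>v w) \<le> 0" if "w \<in> carrier_vec n" for w
    using tmax[OF that] by simp
  hence Xw: "?X *\<^sub>v w = 0\<^sub>v n" if "w \<in> carrier_vec n" for w
    using psd_form_zero[OF Xpsd that] Xpsd that by (force simp: sym_psd_def)
  show "Q = T"
  proof (rule mat_eqI_mult_vec[OF Qc(1) Tc(1)])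
    fix v :: "real vec" assume v: "v \<in> carrier_vec n"
    have "(Q *\<^sub>v v) $ i - (T *\<^sub>v v) $ i = 0" if i: "i < n" for i
    proof -
      have "(Q *\<^sub>v v - T *\<^sub>v v) $ i = 0" using Xw[OF v] Xv[OF v] i by simp
      thus ?thesis using Tc i by simp
    qed
    thus "Q *\<^sub>v v = T *\<^sub>v v" using Qc Tc by (intro eq_vecI) auto
  qed
qed

lemma mat_sqrt_pd:
  assumes n: "n \<ge> 1" and M: "sym_pd n M"
  shows "sym_psd n (mat_sqrt M)" "mat_sqrt M * mat_sqrt M = M"
proof -
  have d: "dim_row M = n" using M by (auto simp: sym_pd_def)
  have "\<exists>!Q. sym_psd n Q \<and> Q * Q = M"
    using psd_sqrt_exists[OF pd_imp_psd[OF M]] pd_sqrt_unique[OF n M] by blast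
  from theI'[OF this] show "sym_psd n (mat_sqrt M)" "mat_sqrt M * mat_sqrt M = M"
    by (simp_all add: mat_sqrt_def d)
qed

text \<open>The properties of the inverse square root that the scaling of the block rows uses.\<close>

lemma mat_inv_sqrt_pd:
  assumes n: "n \<ge> 1" and M: "sym_pd n M"
  shows "mat_inv_sqrt M \<in> carrier_mat n n" "(mat_inv_sqrt M)\<^sup>T = mat_inv_sqrt M"
    "mat_inv_sqrt M * mat_sqrt M = 1\<^sub>m n"
    "mat_inv_sqrt M * M = mat_sqrt M"
proof -
  let ?Q = "mat_sqrt M" and ?W = "mat_inv_sqrt M"
  note Q = mat_sqrt_pd[OF n M]
  have Qc: "?Q \<in> carrier_mat n n" "?Q\<^sup>T = ?Q" using Q by (auto simp: sym_psd_def)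
  have inj: "v = 0\<^sub>v n" if v: "v \<in> carrier_vec n" "?Q *\<^sub>v v = 0\<^sub>v n" for v
  proof -
    have "M *\<^sub>v v = ?Q *\<^sub>v (?Q *\<^sub>v v)"
      using assoc_mult_mat_vec[OF Qc(1) Qc(1) v(1)] Q(2) by simp
    also have "\<dots> = 0\<^sub>v n" using v(2) Qc by (auto intro!: eq_vecI)
    finally show ?thesis by (rule sym_pd_inj[OF M v(1)])
  qed
  note W = mat_inverse_exists[OF Qc(1) inj, folded mat_inv_sqrt_def]
  show W0: "?W \<in> carrier_mat n n" "?W * ?Q = 1\<^sub>m n"
    using W by auto
  show "?W\<^sup>T = ?W" by (rule inverse_of_symmetric[OF Qc W0(1)]) (use W in auto)
  show "?W * M = ?Q"
    using assoc_mult_mat[OF W0(1) Qc(1) Qc(1)] W0(2) Q(2) Qc(1) by simp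
qed

section \<open>Ratios of the polynomials\<close>

text \<open>Divided by \<open>V_{k+1}\<close>, this is the scalar analogue of the recurrence for Schur complements:
\<open>y' = (l - gE) - (l - 1) gR / y\<close> for \<open>y = V_{k+1} / V_k\<close>.\<close>

lemma poly_V_poly_rec:
  "poly (V_poly gE gR (Suc (Suc k))) l =
     (l - gE (Suc k)) * poly (V_poly gE gR (Suc k)) l - (l - 1) * gR (Suc k) * poly (V_poly gE gR k) l"
  by (simp add: algebra_simps)

lemma V_poly_cong:
  assumes "\<And>j. j < k \<Longrightarrow> gE j = gE' j" "\<And>j. 1 \<le> j \<Longrightarrow> j < k \<Longrightarrow> gR j = gR' j"
  shows "V_poly gE gR k = V_poly gE' gR' k"
  using assms by (induction gE gR k rule: V_poly.induct) auto

lemma continuous_on_V_poly: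
  assumes "\<And>j. continuous_on X (\<lambda>t. gE t j)" "\<And>j. continuous_on X (\<lambda>t. gR t j)"
  shows "continuous_on X (\<lambda>t. poly (V_poly (gE t) (gR t) k) l)"
proof (induction k rule: less_induct)
  case (less k)
  consider "k = 0" | "k = 1" | m where "k = Suc (Suc m)" by (metis One_nat_def not0_implies_Suc)
  thus ?case
  proof cases
    case 1
    thus ?thesis by simp
  next
    case 2
    thus ?thesis using assms by (auto intro!: continuous_intros)
  next
    case 3
    thus ?thesis unfolding 3 poly_V_poly_rec
      by (intro continuous_intros assms less.IH) (use 3 in auto)
  qed
qed

text \<open>The admissible parameters, with the extreme eigenvalues replaced by arbitrary bounds.\<close>

definition param_box ::
  "nat \<Rightarrow> (nat \<Rightarrow> real) \<Rightarrow> (nat \<Rightarrow> real) \<Rightarrow> (nat \<Rightarrow> real) \<Rightarrow> (nat \<Rightarrow> real)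
     \<Rightarrow> ((nat \<Rightarrow> real) \<times> (nat \<Rightarrow> real)) set" where
  "param_box N aE bE aR bR = {(gE, gR).
     (\<forall>j \<in> {0..N}. gE j \<in> {aE j .. bE j}) \<and> (\<forall>j \<in> {1..N}. gR j \<in> {aR j .. bR j})}"

text \<open>The index counts block rows from 0: the set with index \<open>k\<close> belongs to the Schur complement of row \<open>k\<close>.\<close>

definition V_ratios ::
  "((nat \<Rightarrow> real) \<times> (nat \<Rightarrow> real)) set \<Rightarrow> real \<Rightarrow> nat \<Rightarrow> real set" where
  "V_ratios G l k =
     (\<lambda>(gE, gR). poly (V_poly gE gR (Suc k)) l / poly (V_poly gE gR k) l) ` G"

lemma param_box_segment:
  assumes g: "(gE, gR) \<in> param_box N aE bE aR bR" and h: "(hE, hR) \<in> param_box N aE bE aR bR"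
    and t: "0 \<le> t" "t \<le> 1"
  shows "(\<lambda>j. (1 - t) * gE j + t * hE j, \<lambda>j. (1 - t) * gR j + t * hR j) \<in> param_box N aE bE aR bR"
proof -
  have "(1 - t) * x + t * y \<in> {a..b}" if "x \<in> {a..b}" "y \<in> {a..b}" for x y a b :: real
  proof -
    have "(1 - t) * a + t * a \<le> (1 - t) * x + t * y" using that t
      by (intro add_mono mult_left_mono) auto
    moreover have "(1 - t) * x + t * y \<le> (1 - t) * b + t * b" using that t
      by (intro add_mono mult_left_mono) auto
    ultimately show ?thesis by (simp add: algebra_simps)
  qed
  thus ?thesis using g h unfolding param_box_def by blast
qed

text \<open>The ratio depends continuously on the parameters as long as its denominator has no zero. The
parameters form a convex set, so the intermediate value theorem on the segment between two
parameter choices applies.\<close>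

lemma V_ratios_convex:
  assumes nv: "\<And>gE gR. (gE, gR) \<in> param_box N aE bE aR bR \<Longrightarrow> poly (V_poly gE gR k) l \<noteq> 0"
    and x: "x \<in> V_ratios (param_box N aE bE aR bR) l k"
    and y: "y \<in> V_ratios (param_box N aE bE aR bR) l k"
    and z: "x \<le> z" "z \<le> y"
  shows "z \<in> V_ratios (param_box N aE bE aR bR) l k"
proof -
  let ?G = "param_box N aE bE aR bR"
  obtain gE gR where g: "(gE, gR) \<in> ?G" "x = poly (V_poly gE gR (Suc k)) l / poly (V_poly gE gR k) l"
    using x by (auto simp: V_ratios_def)
  obtain hE hR where h: "(hE, hR) \<in> ?G" "y = poly (V_poly hE hR (Suc k)) l / poly (V_poly hE hR k) l"
    using y by (auto simp: V_ratios_def)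
  define sE sR where "sE = (\<lambda>t j. (1 - t) * gE j + t * hE j)" "sR = (\<lambda>t j. (1 - t) * gR j + t * hR j)"
  define f where "f = (\<lambda>t. poly (V_poly (sE t) (sR t) (Suc k)) l / poly (V_poly (sE t) (sR t) k) l)"
  have seg: "(sE t, sR t) \<in> ?G" if "t \<in> {0..1}" for t
    using param_box_segment[OF g(1) h(1)] that by (simp add: sE_sR_def)
  have cont: "continuous_on {0..1} (\<lambda>t. poly (V_poly (sE t) (sR t) i) l)" for i
    by (rule continuous_on_V_poly) (auto simp: sE_sR_def intro!: continuous_intros)
  have "continuous_on {0..1} f" unfolding f_def
    by (rule continuous_on_divide[OF cont cont]) (use nv seg in auto)
  moreover have "f 0 = x" "f 1 = y" by (simp_all add: f_def sE_sR_def g h)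
  ultimately obtain t where "0 \<le> t" "t \<le> 1" "f t = z" using IVT'[of f 0 z 1] z by auto
  thus ?thesis using seg[of t] by (force simp: V_ratios_def f_def)
qed

section \<open>The Rayleigh quotient of an inverse\<close>

text \<open>With \<open>z = Y t\<close> the conclusion is about the inverse of \<open>Y\<close>: it says \<open>z . Y^{-1} z = |z|^2 / q\<close> for
some \<open>q\<close> in \<open>J\<close>. Cauchy-Schwarz for the standard form and for the form of \<open>Y\<close> gives
\<open>(t . Y t) / |t|^2 \<le> |z|^2 / (t . z) \<le> (z . Y z) / |z|^2\<close>. The outer terms are Rayleigh quotients of \<open>Y\<close>
and so lie in \<open>J\<close>, and \<open>J\<close> has no gaps.\<close>

lemma inverse_rayleigh_pos:
  fixes Y :: "real mat"
  assumes Y: "Y \<in> carrier_mat n n" "Y\<^sup>T = Y"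
    and RQ: "\<And>w. w \<in> carrier_vec n \<Longrightarrow> w \<noteq> 0\<^sub>v n \<Longrightarrow> \<exists>q\<in>J. w \<bullet> (Y *\<^sub>v w) = q * (w \<bullet> w)"
    and conv: "\<And>x y z. x \<in> J \<Longrightarrow> y \<in> J \<Longrightarrow> x \<le> z \<Longrightarrow> z \<le> y \<Longrightarrow> z \<in> J"
    and pos: "\<And>q. q \<in> J \<Longrightarrow> q > 0"
    and t: "t \<in> carrier_vec n" "Y *\<^sub>v t \<noteq> 0\<^sub>v n"
  shows "\<exists>q\<in>J. (Y *\<^sub>v t) \<bullet> (Y *\<^sub>v t) = q * (t \<bullet> (Y *\<^sub>v t))"
proof -
  let ?y = "Y *\<^sub>v t"
  let ?p = "t \<bullet> ?y"
  have y: "?y \<in> carrier_vec n" using Y t by auto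
  have t0: "t \<noteq> 0\<^sub>v n" using t Y by auto
  have tt: "t \<bullet> t > 0" and yy: "?y \<bullet> ?y > 0" using sq_pos t t0 y by auto
  obtain a where a: "a \<in> J" "?p = a * (t \<bullet> t)" using RQ[OF t(1) t0] by blast
  obtain b where b: "b \<in> J" "?y \<bullet> (Y *\<^sub>v ?y) = b * (?y \<bullet> ?y)" using RQ[OF y t(2)] by blast
  have p: "?p > 0" using a tt pos by simp
  have psd: "sym_psd n Y" unfolding sym_psd_def
  proof (intro conjI ballI)
    fix w :: "real vec" assume w: "w \<in> carrier_vec n"
    show "w \<bullet> (Y *\<^sub>v w) \<ge> 0"
    proof (cases "w = 0\<^sub>v n")
      case True
      thus ?thesis using Y by simp
    next
      case False
      then obtain q where "q \<in> J" "w \<bullet> (Y *\<^sub>v w) = q * (w \<bullet> w)" using RQ[OF w] by blast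
      thus ?thesis using pos[of q] sq_nonneg[of w] by simp
    qed
  qed (use Y in auto)
  let ?q = "(?y \<bullet> ?y) / ?p"
  have "a \<le> ?q"
  proof -
    have "(a * (t \<bullet> t)) * ?p \<le> (t \<bullet> t) * (?y \<bullet> ?y)"
      using cauchy_schwarz_vec[OF t(1) y] a(2) by (simp add: power2_eq_square)
    hence "a * ?p \<le> ?y \<bullet> ?y" using tt by (simp add: mult.assoc mult.left_commute)
    thus ?thesis using p by (simp add: pos_le_divide_eq)
  qed
  moreover have "?q \<le> b"
  proof -
    have "(?y \<bullet> ?y)\<^sup>2 \<le> (b * (?y \<bullet> ?y)) * ?p" using form_cauchy_schwarz[OF psd y t(1)] b(2) by simp
    hence "?y \<bullet> ?y \<le> b * ?p" using yy by (simp add: power2_eq_square mult.assoc mult.left_commute)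
    thus ?thesis using p by (simp add: pos_divide_le_eq)
  qed
  ultimately have "?q \<in> J" using conv[OF a(1) b(1)] by blast
  thus ?thesis using p by (intro bexI[of _ ?q]) auto
qed

text \<open>A set without gaps that misses 0 has one sign, and the negative case is the positive one for
\<open>-Y\<close> and \<open>-J\<close>.\<close>

lemma inverse_rayleigh:
  fixes Y :: "real mat"
  assumes Y: "Y \<in> carrier_mat n n" "Y\<^sup>T = Y"
    and RQ: "\<And>w. w \<in> carrier_vec n \<Longrightarrow> w \<noteq> 0\<^sub>v n \<Longrightarrow> \<exists>q\<in>J. w \<bullet> (Y *\<^sub>v w) = q * (w \<bullet> w)"
    and conv: "\<And>x y z. x \<in> J \<Longrightarrow> y \<in> J \<Longrightarrow> x \<le> z \<Longrightarrow> z \<le> y \<Longrightarrow> z \<in> J"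
    and nz: "0 \<notin> J"
    and t: "t \<in> carrier_vec n" "Y *\<^sub>v t \<noteq> 0\<^sub>v n"
  shows "\<exists>q\<in>J. (Y *\<^sub>v t) \<bullet> (Y *\<^sub>v t) = q * (t \<bullet> (Y *\<^sub>v t))"
proof (cases "\<forall>q\<in>J. q > 0")
  case True
  thus ?thesis 
    by (intro inverse_rayleigh_pos[OF Y RQ _ _ t]) (use conv in blast)+
next
  case False
  have neg: "q < 0" if q: "q \<in> J" for q
  proof (rule ccontr)
    assume "\<not> q < 0"
    moreover obtain r where "r \<in> J" "r \<le> 0" using False by force
    ultimately show False using conv[of r q 0] q nz by auto
  qed
  have Ym: "(- Y) *\<^sub>v w = - (Y *\<^sub>v w)" if "w \<in> carrier_vec n" for w using Y that by simp
  have Yd: "dim_row Y = n" using Y by simp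
  have "\<exists>q\<in>uminus ` J. ((- Y) *\<^sub>v t) \<bullet> ((- Y) *\<^sub>v t) = q * (t \<bullet> ((- Y) *\<^sub>v t))"
  proof (rule inverse_rayleigh_pos)
    show "- Y \<in> carrier_mat n n" "(- Y)\<^sup>T = - Y" using Y by (auto simp: transpose_uminus)
    show "\<exists>q\<in>uminus ` J. w \<bullet> ((- Y) *\<^sub>v w) = q * (w \<bullet> w)"
      if w: "w \<in> carrier_vec n" "w \<noteq> 0\<^sub>v n" for w
      using RQ[OF w] w Yd by (auto simp: Ym)
    show "z \<in> uminus ` J" if "x \<in> uminus ` J" "y \<in> uminus ` J" "x \<le> z" "z \<le> y" for x y z
      using that conv[of "- y" "- x" "- z"] by (auto intro: image_eqI[of _ _ "- z"])
    show "q > 0" if "q \<in> uminus ` J" for q using that neg by auto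
    show "(- Y) *\<^sub>v t \<noteq> 0\<^sub>v n" unfolding Ym[OF t(1)] using t(2) Yd
      by (metis carrier_vec_dim_vec dim_mult_mat_vec uminus_uminus_vec uminus_zero_vec)
  qed (rule t(1))
  thus ?thesis using t Yd by (auto simp: Ym)
qed

section \<open>Block elimination\<close>

text \<open>The coefficients of the system after scaling, seen only through bounds for their Rayleigh
quotients. The last assumption puts \<open>l\<close> outside the root set of every \<open>V_k\<close>.\<close>

locale scaled_system =
  fixes N :: nat and n :: "nat \<Rightarrow> nat" and E R :: "nat \<Rightarrow> real mat"
    and aE bE aR bR :: "nat \<Rightarrow> real" and l :: real
  assumes E: "k \<le> N \<Longrightarrow> E k \<in> carrier_mat (n k) (n k)" "k \<le> N \<Longrightarrow> (E k)\<^sup>T = E k"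
    and R: "k < N \<Longrightarrow> R (Suc k) \<in> carrier_mat (n (Suc k)) (n k)"
    and box: "k \<le> N \<Longrightarrow> aE k \<le> bE k" "1 \<le> k \<Longrightarrow> k \<le> N \<Longrightarrow> aR k \<le> bR k"
    and E_bounds: "k \<le> N \<Longrightarrow> w \<in> carrier_vec (n k) \<Longrightarrow>
      aE k * (w \<bullet> w) \<le> w \<bullet> (E k *\<^sub>v w) \<and> w \<bullet> (E k *\<^sub>v w) \<le> bE k * (w \<bullet> w)"
    and R_bounds: "k < N \<Longrightarrow> w \<in> carrier_vec (n (Suc k)) \<Longrightarrow>
      aR (Suc k) * (w \<bullet> w) \<le> ((R (Suc k))\<^sup>T *\<^sub>v w) \<bullet> ((R (Suc k))\<^sup>T *\<^sub>v w) \<and>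
      ((R (Suc k))\<^sup>T *\<^sub>v w) \<bullet> ((R (Suc k))\<^sup>T *\<^sub>v w) \<le> bR (Suc k) * (w \<bullet> w)"
    and no_root: "1 \<le> k \<Longrightarrow> k \<le> Suc N \<Longrightarrow> (gE, gR) \<in> param_box N aE bE aR bR \<Longrightarrow>
      poly (V_poly gE gR k) l \<noteq> 0"
begin

abbreviation "J \<equiv> V_ratios (param_box N aE bE aR bR) l"

lemma V_nonzero: "k \<le> Suc N \<Longrightarrow> (gE, gR) \<in> param_box N aE bE aR bR \<Longrightarrow> poly (V_poly gE gR k) l \<noteq> 0"
  using no_root by (cases "k = 0") auto

lemma J_convex:
  assumes k: "k \<le> N" and "x \<in> J k" "y \<in> J k" "x \<le> z" "z \<le> y"
  shows "z \<in> J k"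
proof (rule V_ratios_convex[of N aE bE aR bR k l x y z])
  show "poly (V_poly gE gR k) l \<noteq> 0" if "(gE, gR) \<in> param_box N aE bE aR bR" for gE gR
    using V_nonzero[OF _ that] k by simp
qed (use assms in auto)

lemma J_nonzero:
  assumes k: "k \<le> N"
  shows "0 \<notin> J k"
proof
  assume "0 \<in> J k"
  then obtain gE gR where g: "(gE, gR) \<in> param_box N aE bE aR bR"
    "0 = poly (V_poly gE gR (Suc k)) l / poly (V_poly gE gR k) l"
    by (auto simp: V_ratios_def simp del: V_poly.simps)
  thus False using V_nonzero[OF _ g(1), of k] V_nonzero[OF _ g(1), of "Suc k"] k
    by (metis Suc_le_mono divide_eq_0_iff le_SucI)
qed

lemma J_nonempty: "J k \<noteq> {}"
proof -
  have "(aE, aR) \<in> param_box N aE bE aR bR" using box by (auto simp: param_box_def)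
  thus ?thesis by (auto simp: V_ratios_def)
qed

lemma J_zero:
  assumes "g \<in> {aE 0 .. bE 0}"
  shows "l - g \<in> J 0"
proof -
  have "(aE(0 := g), aR) \<in> param_box N aE bE aR bR" using box assms by (auto simp: param_box_def)
  thus ?thesis by (force simp: V_ratios_def)
qed

text \<open>\<open>V_k\<close> and \<open>V_{k+1}\<close> do not depend on the parameters with index \<open>k + 1\<close>, so these can be changed
without changing \<open>q\<close>.\<close>

lemma J_Suc:
  assumes k: "k < N" and q: "q \<in> J k" and gE: "gE \<in> {aE (Suc k) .. bE (Suc k)}"
    and gR: "gR \<in> {aR (Suc k) .. bR (Suc k)}"
  shows "l - gE - (l - 1) * gR / q \<in> J (Suc k)"
proof -
  obtain hE hR where h: "(hE, hR) \<in> param_box N aE bE aR bR"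
    and q: "q = poly (V_poly hE hR (Suc k)) l / poly (V_poly hE hR k) l"
    using q by (auto simp: V_ratios_def)
  let ?E = "hE(Suc k := gE)" and ?R = "hR(Suc k := gR)"
  have mem: "(?E, ?R) \<in> param_box N aE bE aR bR" using h gE gR by (auto simp: param_box_def)
  have eq: "V_poly ?E ?R k = V_poly hE hR k" "V_poly ?E ?R (Suc k) = V_poly hE hR (Suc k)"
    by (rule V_poly_cong; simp)+
  have nz: "poly (V_poly hE hR (Suc k)) l \<noteq> 0" using V_nonzero[OF _ h] k by simp
  have "poly (V_poly ?E ?R (Suc (Suc k))) l / poly (V_poly ?E ?R (Suc k)) l
      = l - gE - (l - 1) * gR / q"
    unfolding poly_V_poly_rec eq using nz by (simp add: q field_simps)
  thus ?thesis using mem unfolding V_ratios_def by force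
qed

lemma E_value:
  assumes k: "k \<le> N" and w: "w \<in> carrier_vec (n k)" "w \<noteq> 0\<^sub>v (n k)"
  obtains g where "g \<in> {aE k .. bE k}" "w \<bullet> (E k *\<^sub>v w) = g * (w \<bullet> w)"
proof
  have p: "w \<bullet> w > 0" by (rule sq_pos[OF w])
  let ?g = "(w \<bullet> (E k *\<^sub>v w)) / (w \<bullet> w)"
  show "?g \<in> {aE k .. bE k}" using E_bounds[OF k w(1)] p by (simp add: field_simps)
  show "w \<bullet> (E k *\<^sub>v w) = ?g * (w \<bullet> w)" using p by simp
qed

lemma R_value:
  assumes k: "k < N" and w: "w \<in> carrier_vec (n (Suc k))" "w \<noteq> 0\<^sub>v (n (Suc k))"
  obtains g where "g \<in> {aR (Suc k) .. bR (Suc k)}"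
    "((R (Suc k))\<^sup>T *\<^sub>v w) \<bullet> ((R (Suc k))\<^sup>T *\<^sub>v w) = g * (w \<bullet> w)"
proof
  let ?z = "(R (Suc k))\<^sup>T *\<^sub>v w"
  have p: "w \<bullet> w > 0" by (rule sq_pos[OF w])
  let ?g = "(?z \<bullet> ?z) / (w \<bullet> w)"
  show "?g \<in> {aR (Suc k) .. bR (Suc k)}" using R_bounds[OF k w(1)] p by (simp add: field_simps)
  show "?z \<bullet> ?z = ?g * (w \<bullet> w)" using p by simp
qed

lemma shifted_E:
  assumes k: "k \<le> N"
  shows "l \<cdot>\<^sub>m 1\<^sub>m (n k) - E k \<in> carrier_mat (n k) (n k)"
    "(l \<cdot>\<^sub>m 1\<^sub>m (n k) - E k)\<^sup>T = l \<cdot>\<^sub>m 1\<^sub>m (n k) - E k"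
    "w \<in> carrier_vec (n k) \<Longrightarrow> (l \<cdot>\<^sub>m 1\<^sub>m (n k) - E k) *\<^sub>v w = l \<cdot>\<^sub>v w - E k *\<^sub>v w"
    "w \<in> carrier_vec (n k) \<Longrightarrow>
      w \<bullet> ((l \<cdot>\<^sub>m 1\<^sub>m (n k) - E k) *\<^sub>v w) = l * (w \<bullet> w) - w \<bullet> (E k *\<^sub>v w)"
proof -
  note Ek = E[OF k]
  show "l \<cdot>\<^sub>m 1\<^sub>m (n k) - E k \<in> carrier_mat (n k) (n k)" using Ek by (auto intro: minus_carrier_mat)
  show "(l \<cdot>\<^sub>m 1\<^sub>m (n k) - E k)\<^sup>T = l \<cdot>\<^sub>m 1\<^sub>m (n k) - E k"
    using Ek by (subst transpose_minus[of _ "n k" "n k"]) (auto intro!: eq_matI)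
  show mv: "(l \<cdot>\<^sub>m 1\<^sub>m (n k) - E k) *\<^sub>v w = l \<cdot>\<^sub>v w - E k *\<^sub>v w" if w: "w \<in> carrier_vec (n k)" for w
    using minus_mult_distrib_mat_vec[OF _ Ek(1) w, of "l \<cdot>\<^sub>m 1\<^sub>m (n k)"] w
    by (simp add: smult_mat_mult_vec[of _ "n k" "n k"])
  show "w \<bullet> ((l \<cdot>\<^sub>m 1\<^sub>m (n k) - E k) *\<^sub>v w) = l * (w \<bullet> w) - w \<bullet> (E k *\<^sub>v w)"
    if w: "w \<in> carrier_vec (n k)"
    unfolding mv[OF w] using w Ek(1) by (subst scalar_prod_minus_distrib[of _ "n k"]) auto
qed

text \<open>One step of block elimination, \<open>Y' = (l - E) - (l - 1) R Y^{-1} R^T\<close>. The Rayleigh quotient of \<open>Y'\<close>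
at \<open>w\<close> is \<open>l - gE - (l - 1) gR / q\<close> with \<open>gE\<close> and \<open>gR\<close> Rayleigh quotients of \<open>E\<close> and \<open>R R^T\<close> at \<open>w\<close>, and with \<open>q\<close>
coming from the Rayleigh quotient of the inverse of \<open>Y\<close> at \<open>R^T w\<close>. This is the recurrence for the
ratios of the polynomials, so the new quotients are again such ratios.\<close>

lemma schur_step:
  assumes k: "k < N"
    and Y: "Y \<in> carrier_mat (n k) (n k)" "Y\<^sup>T = Y"
    and RQ: "\<And>w. w \<in> carrier_vec (n k) \<Longrightarrow> w \<noteq> 0\<^sub>v (n k) \<Longrightarrow> \<exists>q\<in>J k. w \<bullet> (Y *\<^sub>v w) = q * (w \<bullet> w)"
  obtains Z Y' where "Z \<in> carrier_mat (n k) (n k)" "Z * Y = 1\<^sub>m (n k)"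
    "Y' \<in> carrier_mat (n (Suc k)) (n (Suc k))" "Y'\<^sup>T = Y'"
    "\<And>w. w \<in> carrier_vec (n (Suc k)) \<Longrightarrow> Y' *\<^sub>v w =
      l \<cdot>\<^sub>v w - E (Suc k) *\<^sub>v w - (l - 1) \<cdot>\<^sub>v (R (Suc k) *\<^sub>v (Z *\<^sub>v ((R (Suc k))\<^sup>T *\<^sub>v w)))"
    "\<And>w. w \<in> carrier_vec (n (Suc k)) \<Longrightarrow> w \<noteq> 0\<^sub>v (n (Suc k)) \<Longrightarrow>
      \<exists>q\<in>J (Suc k). w \<bullet> (Y' *\<^sub>v w) = q * (w \<bullet> w)"
proof -
  have kN: "k \<le> N" and SkN: "Suc k \<le> N" using k by auto
  let ?m = "n (Suc k)" and ?R = "R (Suc k)"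
  have Rc: "?R \<in> carrier_mat ?m (n k)" and RT: "?R\<^sup>T \<in> carrier_mat (n k) ?m" using R[OF k] by auto
  have inj: "w = 0\<^sub>v (n k)" if w: "w \<in> carrier_vec (n k)" "Y *\<^sub>v w = 0\<^sub>v (n k)" for w
  proof (rule ccontr)
    assume nz: "w \<noteq> 0\<^sub>v (n k)"
    obtain q where "q \<in> J k" "0 = q * (w \<bullet> w)" using RQ[OF w(1) nz] w by auto
    thus False using sq_pos[OF w(1) nz] J_nonzero[OF kN] by auto
  qed
  define Z where "Z = mat_inv Y"
  note Z = mat_inverse_exists[OF Y(1) inj, folded Z_def]
  have ZT: "Z\<^sup>T = Z" by (rule inverse_of_symmetric[OF Y Z(1,2)])
  define C where "C = ?R * Z * ?R\<^sup>T"
  have Cc: "C \<in> carrier_mat ?m ?m" unfolding C_def using Rc Z(1) RT by simp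
  have CT: "C\<^sup>T = C"
  proof -
    have "C\<^sup>T = ?R\<^sup>T\<^sup>T * (?R * Z)\<^sup>T"
      unfolding C_def by (rule transpose_mult[OF mult_carrier_mat[OF Rc Z(1)] RT])
    also have "(?R * Z)\<^sup>T = Z * ?R\<^sup>T" using transpose_mult[OF Rc Z(1)] ZT by simp
    also have "?R\<^sup>T\<^sup>T * (Z * ?R\<^sup>T) = C"
      unfolding C_def using assoc_mult_mat[OF Rc Z(1) RT] by simp
    finally show ?thesis .
  qed
  have Cw: "C *\<^sub>v w = ?R *\<^sub>v (Z *\<^sub>v (?R\<^sup>T *\<^sub>v w))" if w: "w \<in> carrier_vec ?m" for w
  proof -
    have "C *\<^sub>v w = (?R * Z) *\<^sub>v (?R\<^sup>T *\<^sub>v w)"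
      unfolding C_def by (rule assoc_mult_mat_vec[OF mult_carrier_mat[OF Rc Z(1)] RT w])
    also have "\<dots> = ?R *\<^sub>v (Z *\<^sub>v (?R\<^sup>T *\<^sub>v w))"
      by (rule assoc_mult_mat_vec[OF Rc Z(1) mult_mat_vec_carrier[OF RT w]])
    finally show ?thesis .
  qed
  let ?X = "l \<cdot>\<^sub>m 1\<^sub>m ?m - E (Suc k)"
  note X = shifted_E[OF SkN]
  define Y' where "Y' = ?X - (l - 1) \<cdot>\<^sub>m C"
  have lC: "(l - 1) \<cdot>\<^sub>m C \<in> carrier_mat ?m ?m" using Cc by simp
  have Y'c: "Y' \<in> carrier_mat ?m ?m" unfolding Y'_def by (rule minus_carrier_mat[OF lC])
  have lCT: "((l - 1) \<cdot>\<^sub>m C)\<^sup>T = (l - 1) \<cdot>\<^sub>m C"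
    by (subst (2) CT[symmetric]) (intro eq_matI; simp)
  have Y'T: "Y'\<^sup>T = Y'" unfolding Y'_def transpose_minus[OF X(1) lC] X(2) lCT ..
  have Y'w: "Y' *\<^sub>v w = ?X *\<^sub>v w - (l - 1) \<cdot>\<^sub>v (?R *\<^sub>v (Z *\<^sub>v (?R\<^sup>T *\<^sub>v w)))"
    if w: "w \<in> carrier_vec ?m" for w
    unfolding Y'_def minus_mult_distrib_mat_vec[OF X(1) lC w] smult_mat_mult_vec[OF Cc w] Cw[OF w] ..
  have RQ': "\<exists>q\<in>J (Suc k). w \<bullet> (Y' *\<^sub>v w) = q * (w \<bullet> w)"
    if w: "w \<in> carrier_vec ?m" "w \<noteq> 0\<^sub>v ?m" for w
  proof -
    let ?z = "?R\<^sup>T *\<^sub>v w"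
    let ?t = "Z *\<^sub>v ?z"
    have z: "?z \<in> carrier_vec (n k)" and t: "?t \<in> carrier_vec (n k)" using RT Z(1) w by auto
    have Yt: "Y *\<^sub>v ?t = ?z" using assoc_mult_mat_vec[OF Y(1) Z(1) z] Z(2) z by simp
    obtain gE where gE: "gE \<in> {aE (Suc k) .. bE (Suc k)}" "w \<bullet> (E (Suc k) *\<^sub>v w) = gE * (w \<bullet> w)"
      using E_value[OF SkN w] by blast
    obtain gR where gR: "gR \<in> {aR (Suc k) .. bR (Suc k)}" "?z \<bullet> ?z = gR * (w \<bullet> w)"
      using R_value[OF k w] by blast
    have "\<exists>q\<in>J k. ?z \<bullet> ?z = q * (?t \<bullet> ?z)"
    proof (cases "?z = 0\<^sub>v (n k)")
      (* R^T may have a kernel; then gR = 0 and every ratio q serves *)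
      case True
      hence "?z \<bullet> ?z = 0" "?t \<bullet> ?z = 0" using t by auto
      thus ?thesis using J_nonempty by auto
    next
      case False
      thus ?thesis
        using inverse_rayleigh[OF Y RQ _ J_nonzero[OF kN] t] J_convex[OF kN] unfolding Yt by blast
    qed
    then obtain q where q: "q \<in> J k" "?z \<bullet> ?z = q * (?t \<bullet> ?z)" by blast
    have q0: "q \<noteq> 0" using q(1) J_nonzero[OF kN] by auto
    have tz: "?t \<bullet> ?z = gR / q * (w \<bullet> w)" using q(2) gR(2) q0 by (simp add: field_simps)
    have "w \<bullet> (?R *\<^sub>v ?t) = ?z \<bullet> ?t" by (rule transpose_vec_mult_scalar[OF Rc t w(1), symmetric])
    also have "\<dots> = gR / q * (w \<bullet> w)" using comm_scalar_prod[OF z t] tz by simp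
    finally have wRt: "w \<bullet> (?R *\<^sub>v ?t) = gR / q * (w \<bullet> w)" .
    have Xw: "?X *\<^sub>v w \<in> carrier_vec ?m" using X(1) w(1) by (rule mult_mat_vec_carrier)
    have Rt: "?R *\<^sub>v ?t \<in> carrier_vec ?m" using Rc t by simp
    have "w \<bullet> (Y' *\<^sub>v w) = w \<bullet> (?X *\<^sub>v w) - (l - 1) * (w \<bullet> (?R *\<^sub>v ?t))"
      unfolding Y'w[OF w(1)] using scalar_prod_minus_distrib[OF w(1) Xw, of "(l - 1) \<cdot>\<^sub>v (?R *\<^sub>v ?t)"]
        scalar_prod_smult_distrib[OF w(1) Rt] Rt by simp
    also have "\<dots> = (l - gE - (l - 1) * gR / q) * (w \<bullet> w)"
      unfolding X(4)[OF w(1)] gE(2) wRt by (simp add: algebra_simps)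
    finally show ?thesis by (rule bexI[OF _ J_Suc[OF k q(1) gE(1) gR(1)]])
  qed
  show ?thesis
  proof (rule that[OF Z(1,3) Y'c Y'T _ RQ'])
    show "Y' *\<^sub>v w = l \<cdot>\<^sub>v w - E (Suc k) *\<^sub>v w - (l - 1) \<cdot>\<^sub>v (?R *\<^sub>v (Z *\<^sub>v (?R\<^sup>T *\<^sub>v w)))"
      if "w \<in> carrier_vec ?m" for w
      unfolding Y'w[OF that] X(3)[OF that] ..
  qed
qed

text \<open>What the elimination of the first \<open>k\<close> blocks leaves on the right-hand side of row \<open>k\<close>: the coupling
to the next block, which is absent in the last row.\<close>

definition rhs :: "(nat \<Rightarrow> real vec) \<Rightarrow> nat \<Rightarrow> real vec" where
  "rhs v k = (if k < N then ((-1) ^ Suc k * (l - 1)) \<cdot>\<^sub>v ((R (Suc k))\<^sup>T *\<^sub>v v (Suc k)) else 0\<^sub>v (n k))"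

text \<open>The matrix \<open>Y\<close> of row \<open>k\<close> is the Schur complement that remains after the blocks before \<open>k\<close> have been
eliminated. Its Rayleigh quotients avoid 0, which makes it invertible and lets the elimination
continue.\<close>

lemma schur_elimination:
  assumes v: "\<And>k. k \<le> N \<Longrightarrow> v k \<in> carrier_vec (n k)"
    and row0: "l \<cdot>\<^sub>v v 0 - E 0 *\<^sub>v v 0 = rhs v 0"
    and rowS: "\<And>k. k < N \<Longrightarrow> l \<cdot>\<^sub>v v (Suc k) - E (Suc k) *\<^sub>v v (Suc k)
      - (-1) ^ Suc k \<cdot>\<^sub>v (R (Suc k) *\<^sub>v v k) = rhs v (Suc k)"
    and k: "k \<le> N"
  shows "\<exists>Y. Y \<in> carrier_mat (n k) (n k) \<and> Y\<^sup>T = Y \<and> Y *\<^sub>v v k = rhs v k \<and>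
    (\<forall>w \<in> carrier_vec (n k). w \<noteq> 0\<^sub>v (n k) \<longrightarrow> (\<exists>q\<in>J k. w \<bullet> (Y *\<^sub>v w) = q * (w \<bullet> w)))"
  using k
proof (induction k)
  case 0
  let ?Y = "l \<cdot>\<^sub>m 1\<^sub>m (n 0) - E 0"
  note Y = shifted_E[OF 0]
  have "\<exists>q\<in>J 0. w \<bullet> (?Y *\<^sub>v w) = q * (w \<bullet> w)" if w: "w \<in> carrier_vec (n 0)" "w \<noteq> 0\<^sub>v (n 0)" for w
  proof -
    obtain g where g: "g \<in> {aE 0 .. bE 0}" "w \<bullet> (E 0 *\<^sub>v w) = g * (w \<bullet> w)" using E_value[OF 0 w] by blast
    have "w \<bullet> (?Y *\<^sub>v w) = (l - g) * (w \<bullet> w)" unfolding Y(4)[OF w(1)] g(2) by (simp add: algebra_simps)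
    thus ?thesis using J_zero[OF g(1)] by blast
  qed
  moreover have "?Y *\<^sub>v v 0 = rhs v 0" using Y(3)[OF v[OF 0]] row0 by simp
  ultimately show ?case using Y(1,2) by blast
next
  case (Suc k)
  hence k: "k < N" by simp
  from Suc obtain Y where Y: "Y \<in> carrier_mat (n k) (n k)" "Y\<^sup>T = Y" "Y *\<^sub>v v k = rhs v k"
    and RQ: "\<And>w. w \<in> carrier_vec (n k) \<Longrightarrow> w \<noteq> 0\<^sub>v (n k) \<Longrightarrow> \<exists>q\<in>J k. w \<bullet> (Y *\<^sub>v w) = q * (w \<bullet> w)"
    by (meson Suc_leD)
  let ?m = "n (Suc k)" and ?R = "R (Suc k)"
  obtain Z Y' where Z: "Z \<in> carrier_mat (n k) (n k)" "Z * Y = 1\<^sub>m (n k)"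
    and Y': "Y' \<in> carrier_mat ?m ?m" "Y'\<^sup>T = Y'"
    and Y'w: "\<And>w. w \<in> carrier_vec ?m \<Longrightarrow> Y' *\<^sub>v w =
      l \<cdot>\<^sub>v w - E (Suc k) *\<^sub>v w - (l - 1) \<cdot>\<^sub>v (?R *\<^sub>v (Z *\<^sub>v (?R\<^sup>T *\<^sub>v w)))"
    and RQ': "\<And>w. w \<in> carrier_vec ?m \<Longrightarrow> w \<noteq> 0\<^sub>v ?m \<Longrightarrow>
      \<exists>q\<in>J (Suc k). w \<bullet> (Y' *\<^sub>v w) = q * (w \<bullet> w)"
    using schur_step[OF k Y(1,2) RQ] by blast
  have Rc: "?R \<in> carrier_mat ?m (n k)" and RT: "?R\<^sup>T \<in> carrier_mat (n k) ?m" using R[OF k] by auto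
  have vk: "v k \<in> carrier_vec (n k)" and vS: "v (Suc k) \<in> carrier_vec ?m" using v k by auto
  let ?c = "(-1) ^ Suc k :: real"
  let ?z = "?R\<^sup>T *\<^sub>v v (Suc k)"
  have z: "?z \<in> carrier_vec (n k)" and Zz: "Z *\<^sub>v ?z \<in> carrier_vec (n k)" using RT vS Z by auto
  have "v k = Z *\<^sub>v (Y *\<^sub>v v k)" using assoc_mult_mat_vec[OF Z(1) Y(1) vk] Z(2) vk by simp
  also have "\<dots> = (?c * (l - 1)) \<cdot>\<^sub>v (Z *\<^sub>v ?z)"
    unfolding Y(3) rhs_def using k mult_mat_vec[OF Z(1) z] by simp
  finally have "?R *\<^sub>v v k = (?c * (l - 1)) \<cdot>\<^sub>v (?R *\<^sub>v (Z *\<^sub>v ?z))"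
    using mult_mat_vec[OF Rc Zz] by simp
  hence "?c \<cdot>\<^sub>v (?R *\<^sub>v v k) = (l - 1) \<cdot>\<^sub>v (?R *\<^sub>v (Z *\<^sub>v ?z))"
    by (simp add: smult_smult_assoc mult.assoc[symmetric] power_mult_distrib[symmetric])
  hence "Y' *\<^sub>v v (Suc k) = rhs v (Suc k)" using Y'w[OF vS] rowS[OF k] by simp
  thus ?case using Y' RQ' by blast
qed

text \<open>Back substitution: the last Schur complement annihilates the last block of \<open>v\<close>, hence this block
is zero, which makes the right-hand side of the row before it zero, and so on.\<close>

lemma trivial_solution:
  assumes v: "\<And>k. k \<le> N \<Longrightarrow> v k \<in> carrier_vec (n k)"
    and row0: "l \<cdot>\<^sub>v v 0 - E 0 *\<^sub>v v 0 = rhs v 0"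
    and rowS: "\<And>k. k < N \<Longrightarrow> l \<cdot>\<^sub>v v (Suc k) - E (Suc k) *\<^sub>v v (Suc k)
      - (-1) ^ Suc k \<cdot>\<^sub>v (R (Suc k) *\<^sub>v v k) = rhs v (Suc k)"
    and k: "k \<le> N"
  shows "v k = 0\<^sub>v (n k)"
  using k
proof (induction k rule: inc_induct)
  have zero: "v k = 0\<^sub>v (n k)" if k: "k \<le> N" and r: "rhs v k = 0\<^sub>v (n k)" for k
  proof (rule ccontr)
    assume nz: "v k \<noteq> 0\<^sub>v (n k)"
    obtain q where "q \<in> J k" "v k \<bullet> rhs v k = q * (v k \<bullet> v k)"
      using schur_elimination[OF v row0 rowS k] nz v[OF k] by metis
    thus False using sq_pos[OF v[OF k] nz] J_nonzero[OF k] r v[OF k] by auto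
  qed
  {
    case base
    show ?case by (rule zero) (auto simp: rhs_def)
  next
    case (step k)
    have "(R (Suc k))\<^sup>T *\<^sub>v v (Suc k) = 0\<^sub>v (n k)"
      unfolding step.IH using R[of k] step.hyps by (intro eq_vecI) auto
    thus ?case using step.hyps by (intro zero) (auto simp: rhs_def)
  }
qed

end

section \<open>Block matrices\<close>

lemma block_offset_Suc: "block_offset n (Suc k) = block_offset n k + n k"
  by (simp add: block_offset_def)

lemma block_offset_mono: "i \<le> j \<Longrightarrow> block_offset n i \<le> block_offset n j"
  unfolding block_offset_def by (intro sum_mono2) auto

lemma block_index_offset:
  assumes i: "i < n k"
  shows "block_index n (block_offset n k + i) = k"
  unfolding block_index_def
proof (rule Least_equality)
  show "block_offset n k + i < block_offset n (Suc k)" using i by (simp add: block_offset_Suc)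
  fix j assume j: "block_offset n k + i < block_offset n (Suc j)"
  show "k \<le> j"
  proof (rule ccontr)
    assume "\<not> k \<le> j"
    hence "block_offset n (Suc j) \<le> block_offset n k" by (intro block_offset_mono) simp
    thus False using j by simp
  qed
qed

lemma block_offset_cases:
  assumes "r < block_offset n M"
  obtains k i where "k < M" "i < n k" "r = block_offset n k + i"
proof -
  have "\<exists>k i. k < M \<and> i < n k \<and> r = block_offset n k + i"
    using assms
  proof (induction M)
    case 0
    thus ?case by (simp add: block_offset_def)
  next
    case (Suc M)
    show ?case
    proof (cases "r < block_offset n M")
      case True
      thus ?thesis using Suc.IH less_Suc_eq by blast
    next
      case False
      hence "r = block_offset n M + (r - block_offset n M)" "r - block_offset n M < n M"
        using Suc.prems by (auto simp: block_offset_Suc)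
      thus ?thesis by blast
    qed
  qed
  thus ?thesis using that by blast
qed

lemma sum_over_blocks:
  fixes g :: "nat \<Rightarrow> real"
  shows "sum g {..<block_offset n M} = (\<Sum>j<M. \<Sum>i<n j. g (block_offset n j + i))"
proof (induction M)
  case 0
  show ?case by (simp add: block_offset_def)
next
  case (Suc M)
  have "sum g {..<a + b} = sum g {..<a} + (\<Sum>i<b. g (a + i))" for a b
    by (induction b) (auto simp: add.assoc)
  thus ?case using Suc by (simp add: block_offset_Suc)
qed

definition block_part :: "(nat \<Rightarrow> nat) \<Rightarrow> real vec \<Rightarrow> nat \<Rightarrow> real vec" where
  "block_part n u k = vec (n k) (\<lambda>i. u $ (block_offset n k + i))"

lemma block_part_carrier [simp]: "block_part n u k \<in> carrier_vec (n k)"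
  by (simp add: block_part_def)

lemma block_parts_zero:
  assumes u: "u \<in> carrier_vec (block_offset n M)" and z: "\<And>k. k < M \<Longrightarrow> block_part n u k = 0\<^sub>v (n k)"
  shows "u = 0\<^sub>v (block_offset n M)"
proof (rule eq_vecI)
  fix r assume "r < dim_vec (0\<^sub>v (block_offset n M) :: real vec)"
  hence r: "r < block_offset n M" by simp
  then obtain k i where ki: "k < M" "i < n k" "r = block_offset n k + i" by (rule block_offset_cases)
  have "block_part n u k $ i = 0" using z[OF ki(1)] ki(2) by simp
  thus "u $ r = 0\<^sub>v (block_offset n M) $ r" using r ki by (simp add: block_part_def)
qed (use u in simp)

lemma block_matrix_mult_vec:
  assumes u: "u \<in> carrier_vec (block_offset n (Suc N))" and k: "k \<le> N" and i: "i < n k"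
    and F: "\<And>j. j \<le> N \<Longrightarrow> F k j \<in> carrier_mat (n k) (n j)"
  shows "(block_matrix N n F *\<^sub>v u) $ (block_offset n k + i) =
    (\<Sum>j<Suc N. (F k j *\<^sub>v block_part n u j) $ i)"
proof -
  let ?r = "block_offset n k + i" and ?T = "block_offset n (Suc N)"
  have r: "?r < ?T" using i block_offset_mono[of "Suc k" "Suc N" n] k by (simp add: block_offset_Suc)
  have "(block_matrix N n F *\<^sub>v u) $ ?r = (\<Sum>c<?T. block_matrix N n F $$ (?r, c) * u $ c)"
    using r u by (simp add: block_matrix_def scalar_prod_def atLeast0LessThan)
  also have "\<dots> = (\<Sum>j<Suc N. \<Sum>c<n j.
      block_matrix N n F $$ (?r, block_offset n j + c) * u $ (block_offset n j + c))"
    by (rule sum_over_blocks)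
  also have "\<dots> = (\<Sum>j<Suc N. (F k j *\<^sub>v block_part n u j) $ i)"
  proof (rule sum.cong[OF refl])
    fix j assume "j \<in> {..<Suc N}"
    hence j: "j \<le> N" by simp
    have "block_matrix N n F $$ (?r, block_offset n j + c) = F k j $$ (i, c)" if c: "c < n j" for c
    proof -
      have "block_offset n j + c < ?T"
        using c block_offset_mono[of "Suc j" "Suc N" n] j by (simp add: block_offset_Suc)
      thus ?thesis using r i c by (simp add: block_matrix_def block_index_offset)
    qed
    thus "(\<Sum>c<n j. block_matrix N n F $$ (?r, block_offset n j + c) * u $ (block_offset n j + c))
        = (F k j *\<^sub>v block_part n u j) $ i"
      using F[OF j] i by (simp add: scalar_prod_def block_part_def atLeast0LessThan)
  qed
  finally show ?thesis .
qed

text \<open>At most three blocks of a row contribute; the case distinction is the one in the definition of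
the system matrix.\<close>

lemma sum_tridiagonal:
  fixes a b c :: "nat \<Rightarrow> real"
  assumes k: "k \<le> N"
  shows "(\<Sum>j<Suc N. if j = k then a j else if k = Suc j then b j else if j = Suc k then c j else 0)
    = a k + (if k = 0 then 0 else b (k - 1)) + (if k < N then c (Suc k) else 0)"
proof -
  have "(\<Sum>j<Suc N. if j = k then a j else if k = Suc j then b j else if j = Suc k then c j else 0)
     = (\<Sum>j<Suc N. (if j = k then a j else 0) + (if k = Suc j then b j else 0)
         + (if j = Suc k then c j else 0))"
    by (rule sum.cong) auto
  also have "\<dots> = (\<Sum>j<Suc N. if j = k then a j else 0) + (\<Sum>j<Suc N. if k = Suc j then b j else 0)
      + (\<Sum>j<Suc N. if j = Suc k then c j else 0)"
    by (simp only: sum.distrib)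
  also have "(\<Sum>j<Suc N. if j = k then a j else 0) = a k" using k by (subst sum.delta) auto
  also have "(\<Sum>j<Suc N. if k = Suc j then b j else 0) = (if k = 0 then 0 else b (k - 1))"
  proof (cases k)
    case (Suc m)
    have "(\<Sum>j<Suc N. if k = Suc j then b j else 0) = (\<Sum>j<Suc N. if j = m then b j else 0)"
      by (rule sum.cong) (auto simp: Suc)
    thus ?thesis using Suc k by (simp add: sum.delta del: sum.lessThan_Suc)
  qed auto
  also have "(\<Sum>j<Suc N. if j = Suc k then c j else 0) = (if k < N then c (Suc k) else 0)"
    by (subst sum.delta) auto
  finally show ?thesis .
qed

lemma system_matrix_row:
  assumes u: "u \<in> carrier_vec (block_offset n (Suc N))" and k: "k \<le> N" and i: "i < n k"
    and A: "A k \<in> carrier_mat (n k) (n k)"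
    and B: "\<And>j. 1 \<le> j \<Longrightarrow> j \<le> N \<Longrightarrow> B j \<in> carrier_mat (n j) (n (j - 1))"
  shows "(system_matrix N n A B *\<^sub>v u) $ (block_offset n k + i) =
    (-1) ^ k * (A k *\<^sub>v block_part n u k) $ i
    + (if k = 0 then 0 else (B k *\<^sub>v block_part n u (k - 1)) $ i)
    + (if k < N then ((B (Suc k))\<^sup>T *\<^sub>v block_part n u (Suc k)) $ i else 0)"
proof -
  let ?F = "\<lambda>i j. if i = j then (-1) ^ i \<cdot>\<^sub>m A i else if i = Suc j then B i
     else if j = Suc i then (B j)\<^sup>T else 0\<^sub>m (n i) (n j)"
  have F: "?F k j \<in> carrier_mat (n k) (n j)" if "j \<le> N" for j
    using A B[of k] B[of j] k that by auto
  have "(system_matrix N n A B *\<^sub>v u) $ (block_offset n k + i)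
      = (\<Sum>j<Suc N. (?F k j *\<^sub>v block_part n u j) $ i)"
    unfolding system_matrix_def by (rule block_matrix_mult_vec[of u n N k i ?F, OF u k i F])
  also have "\<dots> = (\<Sum>j<Suc N. if j = k then (-1) ^ k * (A k *\<^sub>v block_part n u j) $ i
      else if k = Suc j then (B k *\<^sub>v block_part n u j) $ i
      else if j = Suc k then ((B j)\<^sup>T *\<^sub>v block_part n u j) $ i else 0)"
    using A i by (intro sum.cong) (auto simp: smult_mat_mult_vec[OF A])
  finally show ?thesis unfolding sum_tridiagonal[OF k] .
qed

lemma preconditioner_row:
  assumes u: "u \<in> carrier_vec (block_offset n (Suc N))" and k: "k \<le> N" and i: "i < n k"
    and S: "S k \<in> carrier_mat (n k) (n k)"
    and B: "\<And>j. 1 \<le> j \<Longrightarrow> j \<le> N \<Longrightarrow> B j \<in> carrier_mat (n j) (n (j - 1))"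
  shows "(preconditioner N n B S *\<^sub>v u) $ (block_offset n k + i) =
    (-1) ^ k * (S k *\<^sub>v block_part n u k) $ i
    + (if k < N then ((B (Suc k))\<^sup>T *\<^sub>v block_part n u (Suc k)) $ i else 0)"
proof -
  let ?F = "\<lambda>i j. if i = j then (-1) ^ i \<cdot>\<^sub>m S i
     else if j = Suc i then (B j)\<^sup>T else 0\<^sub>m (n i) (n j)"
  have F: "?F k j \<in> carrier_mat (n k) (n j)" if "j \<le> N" for j
    using S B[of j] k that by auto
  have "(preconditioner N n B S *\<^sub>v u) $ (block_offset n k + i)
      = (\<Sum>j<Suc N. (?F k j *\<^sub>v block_part n u j) $ i)"
    unfolding preconditioner_def by (rule block_matrix_mult_vec[of u n N k i ?F, OF u k i F])
  also have "\<dots> = (\<Sum>j<Suc N. if j = k then (-1) ^ k * (S k *\<^sub>v block_part n u j) $ i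
      else if k = Suc j then 0
      else if j = Suc k then ((B j)\<^sup>T *\<^sub>v block_part n u j) $ i else 0)"
    using S i by (intro sum.cong) (auto simp: smult_mat_mult_vec[OF S])
  finally show ?thesis unfolding sum_tridiagonal[OF k] by simp
qed

lemma preconditioner_carrier:
  "preconditioner N n B S \<in> carrier_mat (block_offset n (Suc N)) (block_offset n (Suc N))"
  by (simp add: preconditioner_def block_matrix_def)

lemma system_matrix_carrier:
  "system_matrix N n A B \<in> carrier_mat (block_offset n (Suc N)) (block_offset n (Suc N))"
  by (simp add: system_matrix_def block_matrix_def)

text \<open>Back substitution in a block upper triangular system with definite diagonal blocks.\<close>

lemma preconditioner_inj:
  assumes S: "\<And>k. k \<le> N \<Longrightarrow> sym_pd (n k) (S k)"
    and B: "\<And>j. 1 \<le> j \<Longrightarrow> j \<le> N \<Longrightarrow> B j \<in> carrier_mat (n j) (n (j - 1))"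
    and u: "u \<in> carrier_vec (block_offset n (Suc N))"
    and Pu: "preconditioner N n B S *\<^sub>v u = 0\<^sub>v (block_offset n (Suc N))"
  shows "u = 0\<^sub>v (block_offset n (Suc N))"
proof -
  have Sc: "S k \<in> carrier_mat (n k) (n k)" if "k \<le> N" for k using S[OF that] by (simp add: sym_pd_def)
  have row: "(-1) ^ k * (S k *\<^sub>v block_part n u k) $ i
    + (if k < N then ((B (Suc k))\<^sup>T *\<^sub>v block_part n u (Suc k)) $ i else 0) = 0"
    if k: "k \<le> N" and i: "i < n k" for k i
  proof -
    have "block_offset n k + i < block_offset n (Suc N)"
      using i block_offset_mono[of "Suc k" "Suc N" n] k by (simp add: block_offset_Suc)
    thus ?thesis using preconditioner_row[where S = S and B = B, OF u k i Sc[OF k] B] Pu by simp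
  qed
  have prev: "block_part n u k = 0\<^sub>v (n k)"
    if k: "k \<le> N" and next0: "k < N \<Longrightarrow> block_part n u (Suc k) = 0\<^sub>v (n (Suc k))" for k
  proof (rule sym_pd_inj[OF S[OF k]])
    show "S k *\<^sub>v block_part n u k = 0\<^sub>v (n k)"
    proof (rule eq_vecI)
      fix i assume "i < dim_vec (0\<^sub>v (n k) :: real vec)"
      hence i: "i < n k" by simp
      have "((B (Suc k))\<^sup>T *\<^sub>v block_part n u (Suc k)) $ i = 0" if kN: "k < N"
        using next0[OF kN] B[of "Suc k"] kN i by simp
      hence "(S k *\<^sub>v block_part n u k) $ i = 0" using row[OF k i] by (auto split: if_splits)
      thus "(S k *\<^sub>v block_part n u k) $ i = 0\<^sub>v (n k) $ i" using i by simp
    qed (use Sc[OF k] in simp)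
  qed simp
  have "block_part n u k = 0\<^sub>v (n k)" if "k \<le> N" for k
    using that
  proof (induction k rule: inc_induct)
    case base
    show ?case by (rule prev) auto
  next
    case (step k)
    show ?case by (rule prev) (use step in simp_all)
  qed
  thus ?thesis using block_parts_zero[OF u] by simp
qed

section \<open>Scaling by the inverse square roots\<close>

lemma congruence_symmetric:
  fixes W A :: "real mat"
  assumes W: "W \<in> carrier_mat n n" "W\<^sup>T = W" and A: "A \<in> carrier_mat n n" "A\<^sup>T = A"
  shows "(W * A * W)\<^sup>T = W * A * W"
proof -
  have "(W * A * W)\<^sup>T = W\<^sup>T * (W * A)\<^sup>T"
    by (rule transpose_mult[OF mult_carrier_mat[OF W(1) A(1)] W(1)])
  also have "(W * A)\<^sup>T = A * W" using transpose_mult[OF W(1) A(1)] W A by simp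
  also have "W\<^sup>T * (A * W) = W * A * W" using assoc_mult_mat[OF W(1) A(1) W(1)] W by simp
  finally show ?thesis .
qed

lemma triple_mult_vec:
  fixes X Y Z :: "real mat"
  assumes X: "X \<in> carrier_mat a b" and Y: "Y \<in> carrier_mat b c" and Z: "Z \<in> carrier_mat c d"
    and w: "w \<in> carrier_vec d"
  shows "(X * Y * Z) *\<^sub>v w = X *\<^sub>v (Y *\<^sub>v (Z *\<^sub>v w))"
  unfolding assoc_mult_mat_vec[OF mult_carrier_mat[OF X Y] Z w]
  by (rule assoc_mult_mat_vec[OF X Y mult_mat_vec_carrier[OF Z w]])

lemma transpose_triple:
  assumes W: "W \<in> carrier_mat m m" "W\<^sup>T = W" and X: "X \<in> carrier_mat n n" "X\<^sup>T = X"
    and B: "(B :: real mat) \<in> carrier_mat m n"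
  shows "(W * B * X)\<^sup>T = X * B\<^sup>T * W"
proof -
  have BT: "B\<^sup>T \<in> carrier_mat n m" using B by simp
  have "(W * B * X)\<^sup>T = X\<^sup>T * (W * B)\<^sup>T"
    by (rule transpose_mult[OF mult_carrier_mat[OF W(1) B] X(1)])
  also have "(W * B)\<^sup>T = B\<^sup>T * W" using transpose_mult[OF W(1) B] W by simp
  also have "X\<^sup>T * (B\<^sup>T * W) = X * B\<^sup>T * W" using assoc_mult_mat[OF X(1) BT W(1)] X by simp
  finally show ?thesis .
qed

lemma gram_matrix:
  assumes R: "(R :: real mat) \<in> carrier_mat m n"
  shows "R * R\<^sup>T \<in> carrier_mat m m" "(R * R\<^sup>T)\<^sup>T = R * R\<^sup>T"
    "w \<in> carrier_vec m \<Longrightarrow> w \<bullet> ((R * R\<^sup>T) *\<^sub>v w) = (R\<^sup>T *\<^sub>v w) \<bullet> (R\<^sup>T *\<^sub>v w)"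
proof -
  have RT: "R\<^sup>T \<in> carrier_mat n m" using R by simp
  show "R * R\<^sup>T \<in> carrier_mat m m" by (rule mult_carrier_mat[OF R RT])
  show "(R * R\<^sup>T)\<^sup>T = R * R\<^sup>T" unfolding transpose_mult[OF R RT] by simp
  assume w: "w \<in> carrier_vec m"
  show "w \<bullet> ((R * R\<^sup>T) *\<^sub>v w) = (R\<^sup>T *\<^sub>v w) \<bullet> (R\<^sup>T *\<^sub>v w)"
    unfolding assoc_mult_mat_vec[OF R RT w]
    by (rule transpose_vec_mult_scalar[OF R mult_mat_vec_carrier[OF RT w] w, symmetric])
qed

text \<open>A block row multiplied by an inverse square root, arranged for the elimination: the coupling \<open>d\<close> to the
previous block stays on the left, the coupling \<open>b\<close> to the next block moves to the right.\<close>

lemma mult_row_equation: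
  fixes W :: "real mat"
  assumes W: "W \<in> carrier_mat m m"
    and a: "a \<in> carrier_vec m" and d: "d \<in> carrier_vec m" and b: "b \<in> carrier_vec m"
    and s: "s \<in> carrier_vec m"
    and eq: "a + c \<cdot>\<^sub>v d + e \<cdot>\<^sub>v b = l \<cdot>\<^sub>v s"
  shows "l \<cdot>\<^sub>v (W *\<^sub>v s) - W *\<^sub>v a - c \<cdot>\<^sub>v (W *\<^sub>v d) = e \<cdot>\<^sub>v (W *\<^sub>v b)"
proof -
  have "W *\<^sub>v (a + c \<cdot>\<^sub>v d + e \<cdot>\<^sub>v b) = W *\<^sub>v a + c \<cdot>\<^sub>v (W *\<^sub>v d) + e \<cdot>\<^sub>v (W *\<^sub>v b)"
    using mult_add_distrib_mat_vec[OF W, of "a + c \<cdot>\<^sub>v d" "e \<cdot>\<^sub>v b"]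
      mult_add_distrib_mat_vec[OF W a, of "c \<cdot>\<^sub>v d"] mult_mat_vec[OF W d] mult_mat_vec[OF W b] a b d
    by simp
  hence sum: "W *\<^sub>v a + c \<cdot>\<^sub>v (W *\<^sub>v d) + e \<cdot>\<^sub>v (W *\<^sub>v b) = l \<cdot>\<^sub>v (W *\<^sub>v s)"
    unfolding eq mult_mat_vec[OF W s] by simp
  show ?thesis unfolding sum[symmetric] using W by (intro eq_vecI) (auto simp del: index_mult_mat_vec)
qed

text \<open>Block row \<open>k\<close> of the generalised eigenvalue problem, multiplied by \<open>(-1)^k\<close> so that the diagonal
blocks lose their signs. The couplings that are absent in the first and in the last row are
replaced by zero vectors.\<close>

lemma eigenvector_block_equation:
  fixes A B S :: "nat \<Rightarrow> real mat"
  assumes A: "\<And>k. k \<le> N \<Longrightarrow> A k \<in> carrier_mat (n k) (n k)"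
    and B: "\<And>k. 1 \<le> k \<Longrightarrow> k \<le> N \<Longrightarrow> B k \<in> carrier_mat (n k) (n (k - 1))"
    and S: "\<And>k. k \<le> N \<Longrightarrow> sym_pd (n k) (S k)"
    and ev: "eigenvalue (mat_inv (preconditioner N n B S) * system_matrix N n A B) l"
  obtains u where "u \<in> carrier_vec (block_offset n (Suc N))" "u \<noteq> 0\<^sub>v (block_offset n (Suc N))"
    "\<And>k. k \<le> N \<Longrightarrow>
      A k *\<^sub>v block_part n u k
      + (-1) ^ k \<cdot>\<^sub>v (if k = 0 then 0\<^sub>v (n k) else B k *\<^sub>v block_part n u (k - 1))
      + ((-1) ^ k * (1 - l)) \<cdot>\<^sub>v (if k < N then (B (Suc k))\<^sup>T *\<^sub>v block_part n u (Suc k) else 0\<^sub>v (n k))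
      = l \<cdot>\<^sub>v (S k *\<^sub>v block_part n u k)"
proof -
  let ?P = "preconditioner N n B S" and ?A = "system_matrix N n A B"
  let ?T = "block_offset n (Suc N)"
  note Pc = preconditioner_carrier[of N n B S] and Ac = system_matrix_carrier[of N n A B]
  have inj: "x = 0\<^sub>v ?T" if "x \<in> carrier_vec ?T" "?P *\<^sub>v x = 0\<^sub>v ?T" for x
    by (rule preconditioner_inj[of N n S B]) (use S B that in auto)
  have Pinv: "mat_inv ?P \<in> carrier_mat ?T ?T" "?P * mat_inv ?P = 1\<^sub>m ?T"
    by (rule mat_inverse_exists[OF Pc], rule inj, assumption+)+
  have c: "mat_inv ?P * ?A \<in> carrier_mat ?T ?T" by (rule mult_carrier_mat[OF Pinv(1) Ac])
  obtain u where u: "u \<in> carrier_vec ?T" "u \<noteq> 0\<^sub>v ?T" "(mat_inv ?P * ?A) *\<^sub>v u = l \<cdot>\<^sub>v u"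
    using ev c unfolding eigenvalue_def eigenvector_def by auto
  have Au: "?A *\<^sub>v u \<in> carrier_vec ?T" by (rule mult_mat_vec_carrier[OF Ac u(1)])
  have "?A *\<^sub>v u = (?P * mat_inv ?P) *\<^sub>v (?A *\<^sub>v u)"
    using Au by (simp only: Pinv(2) one_mult_mat_vec)
  also have "\<dots> = ?P *\<^sub>v (mat_inv ?P *\<^sub>v (?A *\<^sub>v u))" by (rule assoc_mult_mat_vec[OF Pc Pinv(1) Au])
  also have "mat_inv ?P *\<^sub>v (?A *\<^sub>v u) = l \<cdot>\<^sub>v u"
    using u(3) unfolding assoc_mult_mat_vec[OF Pinv(1) Ac u(1)] .
  finally have eq: "?A *\<^sub>v u = l \<cdot>\<^sub>v (?P *\<^sub>v u)" using mult_mat_vec[OF Pc u(1)] by simp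
  have Sc: "S k \<in> carrier_mat (n k) (n k)" if "k \<le> N" for k using S[OF that] by (simp add: sym_pd_def)
  show ?thesis
  proof (rule that[OF u(1,2)])
    fix k assume k: "k \<le> N"
    let ?c = "(-1) ^ k :: real"
    let ?a = "A k *\<^sub>v block_part n u k" and ?s = "S k *\<^sub>v block_part n u k"
    let ?d = "if k = 0 then 0\<^sub>v (n k) else B k *\<^sub>v block_part n u (k - 1)"
    let ?b = "if k < N then (B (Suc k))\<^sup>T *\<^sub>v block_part n u (Suc k) else 0\<^sub>v (n k)"
    have a: "?a \<in> carrier_vec (n k)" by (rule mult_mat_vec_carrier[OF A[OF k]]) simp
    have s: "?s \<in> carrier_vec (n k)" by (rule mult_mat_vec_carrier[OF Sc[OF k]]) simp
    have d: "?d \<in> carrier_vec (n k)"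
      using mult_mat_vec_carrier[OF B[of k] block_part_carrier[of n u "k - 1"]] k by auto
    have b: "?b \<in> carrier_vec (n k)"
      using mult_mat_vec_carrier[OF _ block_part_carrier[of n u "Suc k"], of "(B (Suc k))\<^sup>T" "n k"]
        B[of "Suc k"] by auto
    have entry: "?a $ i + ?c * ?d $ i + (?c * (1 - l)) * ?b $ i = l * ?s $ i" if i: "i < n k" for i
    proof -
      have "block_offset n k + i < ?T"
        using i block_offset_mono[of "Suc k" "Suc N" n] k by (simp add: block_offset_Suc)
      hence "(?A *\<^sub>v u) $ (block_offset n k + i) = l * (?P *\<^sub>v u) $ (block_offset n k + i)"
        unfolding eq using Pc by simp
      hence "?c * ?a $ i + ?d $ i + ?b $ i = l * (?c * ?s $ i + ?b $ i)"
        using system_matrix_row[where A = A and B = B, OF u(1) k i A[OF k] B]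
          preconditioner_row[where S = S and B = B, OF u(1) k i Sc[OF k] B] i
        by (simp split: if_splits del: index_mult_mat_vec)
      thus ?thesis by (cases "even k") (simp_all add: algebra_simps del: index_mult_mat_vec)
    qed
    show "?a + ?c \<cdot>\<^sub>v ?d + (?c * (1 - l)) \<cdot>\<^sub>v ?b = l \<cdot>\<^sub>v ?s"
    proof (rule eq_vecI)
      fix i assume "i < dim_vec (l \<cdot>\<^sub>v ?s)"
      hence i: "i < n k" by (simp only: index_smult_vec carrier_vecD[OF s])
      note dv = carrier_vecD[OF a] carrier_vecD[OF d] carrier_vecD[OF b] carrier_vecD[OF s]
      show "(?a + ?c \<cdot>\<^sub>v ?d + (?c * (1 - l)) \<cdot>\<^sub>v ?b) $ i = (l \<cdot>\<^sub>v ?s) $ i"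
        using entry[OF i] i dv by (simp only: index_add_vec index_smult_vec)
    qed (simp only: index_add_vec index_smult_vec carrier_vecD[OF b] carrier_vecD[OF s])
  qed
qed

theorem theorem2:
  fixes N :: nat and n :: "nat \<Rightarrow> nat" and A B S :: "nat \<Rightarrow> real mat" and l :: real
  assumes "N \<ge> 1"
    and "\<And>k. k \<le> N \<Longrightarrow> n k \<ge> 1"
    and "\<And>k. 1 \<le> k \<Longrightarrow> k \<le> N \<Longrightarrow> n k \<le> n (k - 1)"
    and "sym_pd (n 0) (A 0)"
    and "\<And>k. 1 \<le> k \<Longrightarrow> k \<le> N \<Longrightarrow> sym_psd (n k) (A k)"
    and "\<And>k. 1 \<le> k \<Longrightarrow> k \<le> N \<Longrightarrow> B k \<in> carrier_mat (n k) (n (k - 1))"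
    and "\<And>k. 1 \<le> k \<Longrightarrow> k \<le> N \<Longrightarrow> full_rank (B k)"
    and "\<And>k. k \<le> N \<Longrightarrow> sym_pd (n k) (S k)"
    and "eigenvalue (mat_inv (preconditioner N n B S) * system_matrix N n A B) l"
  shows "l \<in> I_le N A B S (N + 1)"
proof (rule ccontr)
  assume notin: "l \<notin> I_le N A B S (N + 1)"
  note dim = assms(2) and B = assms(6) and S = assms(8)
  have A: "A k \<in> carrier_mat (n k) (n k)" "(A k)\<^sup>T = A k" if "k \<le> N" for k
    using assms(4,5) that by (cases "k = 0"; auto simp: sym_pd_def sym_psd_def)+
  obtain u where u: "u \<in> carrier_vec (block_offset n (Suc N))" "u \<noteq> 0\<^sub>v (block_offset n (Suc N))"
    and eq: "\<And>k. k \<le> N \<Longrightarrow>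
      A k *\<^sub>v block_part n u k
      + (-1) ^ k \<cdot>\<^sub>v (if k = 0 then 0\<^sub>v (n k) else B k *\<^sub>v block_part n u (k - 1))
      + ((-1) ^ k * (1 - l)) \<cdot>\<^sub>v (if k < N then (B (Suc k))\<^sup>T *\<^sub>v block_part n u (Suc k) else 0\<^sub>v (n k))
      = l \<cdot>\<^sub>v (S k *\<^sub>v block_part n u k)"
    using eigenvector_block_equation[OF A(1) B S assms(9)] by blast
  define U where "U = block_part n u"
  have U: "U k \<in> carrier_vec (n k)" for k by (simp add: U_def)
  define W where "W = (\<lambda>k. mat_inv_sqrt (S k))"
  define Q where "Q = (\<lambda>k. mat_sqrt (S k))"
  have W: "W k \<in> carrier_mat (n k) (n k)" "(W k)\<^sup>T = W k" "W k * Q k = 1\<^sub>m (n k)" "W k * S k = Q k"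
    and Q: "Q k \<in> carrier_mat (n k) (n k)" and Sc: "S k \<in> carrier_mat (n k) (n k)"
    if "k \<le> N" for k
    using mat_inv_sqrt_pd[OF dim[OF that] S[OF that]] mat_sqrt_pd[OF dim[OF that] S[OF that]]
      S[OF that] unfolding W_def Q_def sym_psd_def sym_pd_def by auto
  (* the change of variables that turns every diagonal block of the preconditioner into the identity, up to its sign *)
  define v where "v = (\<lambda>k. Q k *\<^sub>v U k)"
  have v: "v k \<in> carrier_vec (n k)" if "k \<le> N" for k
    unfolding v_def by (rule mult_mat_vec_carrier[OF Q[OF that] U])
  have Wv: "W k *\<^sub>v v k = U k" if "k \<le> N" for k
    unfolding v_def assoc_mult_mat_vec[OF W(1)[OF that] Q[OF that] U, symmetric] W(3)[OF that]
    using U by simp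
  define E where "E = E_mat A S"
  define R where "R = R_mat B S"
  have E_eq: "E k = W k * A k * W k" for k by (simp add: E_def E_mat_def W_def)
  have R_eq: "R (Suc k) = W (Suc k) * B (Suc k) * W k" for k by (simp add: R_def R_mat_def W_def)
  have E: "E k \<in> carrier_mat (n k) (n k)" "(E k)\<^sup>T = E k" if "k \<le> N" for k
    unfolding E_eq using congruence_symmetric[OF W(1,2)[OF that] A[OF that]]
      mult_carrier_mat[OF mult_carrier_mat[OF W(1)[OF that] A(1)[OF that]] W(1)[OF that]] by auto
  have Bc: "B (Suc k) \<in> carrier_mat (n (Suc k)) (n k)" if "k < N" for k
    using B[of "Suc k"] that by simp
  have R: "R (Suc k) \<in> carrier_mat (n (Suc k)) (n k)" if k: "k < N" for k
    unfolding R_eq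
    by (rule mult_carrier_mat[OF mult_carrier_mat[OF W(1) Bc] W(1)]) (use k in auto)
  have RT_eq: "(R (Suc k))\<^sup>T = W k * (B (Suc k))\<^sup>T * W (Suc k)" if k: "k < N" for k
    unfolding R_eq by (rule transpose_triple[OF W(1,2) W(1,2) Bc]) (use k in auto)
  let ?aE = "\<lambda>k. min_eig (E_mat A S k)" and ?bE = "\<lambda>k. max_eig (E_mat A S k)"
  let ?aR = "\<lambda>k. min_eig (R_mat B S k * (R_mat B S k)\<^sup>T)"
  let ?bR = "\<lambda>k. max_eig (R_mat B S k * (R_mat B S k)\<^sup>T)"
  interpret sys: scaled_system N n E R ?aE ?bE ?aR ?bR l
  proof
    fix k assume k: "k \<le> N"
    show "E k \<in> carrier_mat (n k) (n k)" "(E k)\<^sup>T = E k" by (fact E[OF k])+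
    show "?aE k \<le> ?bE k" using rayleigh_spectrum_bounds(3)[OF E[OF k] dim[OF k]] by (simp add: E_def)
    show "?aE k * (w \<bullet> w) \<le> w \<bullet> (E k *\<^sub>v w) \<and> w \<bullet> (E k *\<^sub>v w) \<le> ?bE k * (w \<bullet> w)"
      if "w \<in> carrier_vec (n k)" for w
      using rayleigh_spectrum_bounds(1,2)[OF E[OF k] dim[OF k] that] by (simp add: E_def)
  next
    fix k assume k: "k < N"
    hence Sk: "Suc k \<le> N" by simp
    show "R (Suc k) \<in> carrier_mat (n (Suc k)) (n k)" by (rule R[OF k])
    note G = gram_matrix[OF R[OF k]]
    show "?aR (Suc k) * (w \<bullet> w) \<le> ((R (Suc k))\<^sup>T *\<^sub>v w) \<bullet> ((R (Suc k))\<^sup>T *\<^sub>v w) \<and>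
      ((R (Suc k))\<^sup>T *\<^sub>v w) \<bullet> ((R (Suc k))\<^sup>T *\<^sub>v w) \<le> ?bR (Suc k) * (w \<bullet> w)"
      if w: "w \<in> carrier_vec (n (Suc k))" for w
      using rayleigh_spectrum_bounds(1,2)[OF G(1,2) dim[OF Sk] w]
      unfolding G(3)[OF w] by (simp add: R_def)
  next
    fix k assume "1 \<le> k" and k: "k \<le> N"
    then obtain m where m: "k = Suc m" "m < N" by (cases k) auto
    note G = gram_matrix[OF R[OF m(2)]]
    show "?aR k \<le> ?bR k"
      using rayleigh_spectrum_bounds(3)[OF G(1,2) dim] m by (simp add: R_def)
  next
    fix k gE gR assume k: "1 \<le> k" "k \<le> Suc N" and g: "(gE, gR) \<in> param_box N ?aE ?bE ?aR ?bR"
    have "admissible N A B S gE gR" using g unfolding param_box_def admissible_def by simp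
    thus "poly (V_poly gE gR k) l \<noteq> 0" using notin k unfolding I_le_def I_set_def by auto
  qed
  have Ev: "E k *\<^sub>v v k = W k *\<^sub>v (A k *\<^sub>v U k)" if k: "k \<le> N" for k
    unfolding E_eq triple_mult_vec[OF W(1)[OF k] A(1)[OF k] W(1)[OF k] v[OF k]] Wv[OF k] ..
  have Rv: "R (Suc k) *\<^sub>v v k = W (Suc k) *\<^sub>v (B (Suc k) *\<^sub>v U k)" if k: "k < N" for k
  proof -
    have le: "Suc k \<le> N" "k \<le> N" using k by auto
    show ?thesis
      unfolding R_eq triple_mult_vec[OF W(1)[OF le(1)] Bc[OF k] W(1)[OF le(2)] v[OF le(2)]] Wv[OF le(2)] ..
  qed
  have RTv: "(R (Suc k))\<^sup>T *\<^sub>v v (Suc k) = W k *\<^sub>v ((B (Suc k))\<^sup>T *\<^sub>v U (Suc k))" if k: "k < N" for k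
  proof -
    have le: "Suc k \<le> N" "k \<le> N" using k by auto
    have BT: "(B (Suc k))\<^sup>T \<in> carrier_mat (n k) (n (Suc k))" using Bc[OF k] by simp
    show ?thesis
      unfolding RT_eq[OF k] triple_mult_vec[OF W(1)[OF le(2)] BT W(1)[OF le(1)] v[OF le(1)]] Wv[OF le(1)] ..
  qed
  let ?d = "\<lambda>k. if k = 0 then 0\<^sub>v (n k) else B k *\<^sub>v U (k - 1)"
  let ?b = "\<lambda>k. if k < N then (B (Suc k))\<^sup>T *\<^sub>v U (Suc k) else 0\<^sub>v (n k)"
  (* the first row is the case in which the coupling d to the previous block is zero *)
  have row: "l \<cdot>\<^sub>v v k - E k *\<^sub>v v k - (-1) ^ k \<cdot>\<^sub>v (W k *\<^sub>v ?d k) = sys.rhs v k" if k: "k \<le> N" for k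
  proof -
    have a: "A k *\<^sub>v U k \<in> carrier_vec (n k)" by (rule mult_mat_vec_carrier[OF A(1)[OF k] U])
    have s: "S k *\<^sub>v U k \<in> carrier_vec (n k)" by (rule mult_mat_vec_carrier[OF Sc[OF k] U])
    have d: "?d k \<in> carrier_vec (n k)"
      using mult_mat_vec_carrier[OF B[of k] U[of "k - 1"]] k by auto
    have b: "?b k \<in> carrier_vec (n k)"
      using mult_mat_vec_carrier[OF _ U[of "Suc k"], of "(B (Suc k))\<^sup>T" "n k"] Bc[of k] by auto
    have WS: "W k *\<^sub>v (S k *\<^sub>v U k) = v k"
      unfolding v_def assoc_mult_mat_vec[OF W(1)[OF k] Sc[OF k] U, symmetric] W(4)[OF k] ..
    have "l \<cdot>\<^sub>v v k - E k *\<^sub>v v k - (-1) ^ k \<cdot>\<^sub>v (W k *\<^sub>v ?d k)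
        = ((-1) ^ k * (1 - l)) \<cdot>\<^sub>v (W k *\<^sub>v ?b k)"
      using mult_row_equation[OF W(1)[OF k] a d b s eq[OF k, folded U_def]] unfolding WS Ev[OF k] .
    also have "\<dots> = sys.rhs v k"
    proof (cases "k < N")
      case True
      have c: "(-1) ^ Suc k * (l - 1) = (-1) ^ k * (1 - l)" by (simp add: algebra_simps)
      show ?thesis unfolding sys.rhs_def RTv[OF True] c using True by simp
    next
      case False
      have "W k *\<^sub>v 0\<^sub>v (n k) = 0\<^sub>v (n k)" using W(1)[OF k] by (intro eq_vecI) auto
      moreover have "c \<cdot>\<^sub>v 0\<^sub>v (n k) = 0\<^sub>v (n k)" for c :: real by (intro eq_vecI) auto
      ultimately show ?thesis using False by (simp add: sys.rhs_def)
    qed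
    finally show ?thesis .
  qed
  have row0: "l \<cdot>\<^sub>v v 0 - E 0 *\<^sub>v v 0 = sys.rhs v 0"
  proof -
    have W0: "W 0 *\<^sub>v 0\<^sub>v (n 0) = 0\<^sub>v (n 0)" using W(1)[of 0] by (intro eq_vecI) auto
    have x: "l \<cdot>\<^sub>v v 0 - E 0 *\<^sub>v v 0 \<in> carrier_vec (n 0)" using E(1)[of 0] v[of 0] by simp
    have "l \<cdot>\<^sub>v v 0 - E 0 *\<^sub>v v 0 = l \<cdot>\<^sub>v v 0 - E 0 *\<^sub>v v 0 - (-1) ^ 0 \<cdot>\<^sub>v 0\<^sub>v (n 0)"
      using x by (intro eq_vecI) auto
    thus ?thesis using row[of 0] W0 by simp
  qed
  have rowS: "l \<cdot>\<^sub>v v (Suc k) - E (Suc k) *\<^sub>v v (Suc k) - (-1) ^ Suc k \<cdot>\<^sub>v (R (Suc k) *\<^sub>v v k)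
      = sys.rhs v (Suc k)" if k: "k < N" for k
    using row[of "Suc k"] k Rv[OF k] by simp
  have v0: "v k = 0\<^sub>v (n k)" if "k \<le> N" for k
    by (rule sys.trivial_solution[OF v row0 rowS that])
  have "block_part n u k = 0\<^sub>v (n k)" if k: "k < Suc N" for k
  proof -
    have "U k = W k *\<^sub>v v k" using Wv[of k] k by simp
    also have "\<dots> = 0\<^sub>v (n k)" using v0[of k] W(1)[of k] k by (intro eq_vecI) auto
    finally show ?thesis by (simp add: U_def)
  qed
  hence "u = 0\<^sub>v (block_offset n (Suc N))" by (rule block_parts_zero[OF u(1)])
  thus False using u(2) by simp
qed

end
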